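(* Fix any integers $d\ge 2$ and $1\le l<k<\infty$, and consider the two-edge long-range percolation model (lengths $l$ and $k$) on the rooted oriented $d$-ary tree, with critical parameters $p_c(\cdot)$ and $q_c(\cdot)$ as defined in the context. If $q'>q''>0$ are such that $p_c(q'')>0$, then $p_c(q')<p_c(q'')$. If $p'>p''>0$ are such that $q_c(p'')>0$, then $q_c(p')<q_c(p'')$.
   Context: Model: on the rooted oriented $d$-ary tree with root $o$ (every vertex has $d$ children), add for each vertex $v$ oriented edges of length $l$ from $v$ to each of its $d^l$ descendants exactly $l$ generations below, and oriented edges of length $k$ from $v$ to each of its $d^k$ descendants exactly $k$ generations below. Each edge of length $l$ is open with probability $p$ and each edge of length $k$ is open with probability $q$, all independently; only these edges are used for percolation. An open path is a sequence of vertices connected by (oriented) open edges; $\mathcal{C}(o)$ is the set of vertices $w$ such that there is an open path from $o$ to $w$, and $\theta(p,q)=\mathbb{P}(|\mathcal{C}(o)|=\infty)$. Define $p_c(q)=\inf\{p\in(0,1):\theta(p,q)>0\}$ and $q_c(p)=\inf\{q\in(0,1):\theta(p,q)>0\}$. The arguments $p',p'',q',q''$ are probabilities, i.e. lie in $[0,1]$. *)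

theory Defs
  imports "HOL-Probability.Probability"
begin

text \<open>A vertex of the rooted d-ary tree is the word of child indices read along the way
  from the root, so the root is the empty word, the children of \<open>v\<close> are \<open>v @ [i]\<close>
  with \<open>i < d\<close>, and the descendants \<open>n\<close> generations below \<open>v\<close> are \<open>v @ u\<close> with \<open>length u = n\<close>.\<close>

type_synonym vertex = "nat list"
type_synonym edge = "vertex \<times> vertex"

definition vertices :: "nat \<Rightarrow> vertex set" where
  "vertices d = lists {..<d}"

definition edges_of_length :: "nat \<Rightarrow> nat \<Rightarrow> edge set" where
  "edges_of_length d n = {(v, v @ u) | v u. v \<in> vertices d \<and> u \<in> vertices d \<and> length u = n}"

definition edges :: "nat \<Rightarrow> nat \<Rightarrow> nat \<Rightarrow> edge set" where
  "edges d l k = edges_of_length d l \<union> edges_of_length d k"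

text \<open>A configuration maps each edge to whether it is open. For \<open>l \<noteq> k\<close> the two classes of edges
  are disjoint. The parameters are meant to be in the unit interval, as the library's Bernoulli
  distribution truncates other values to it.\<close>

definition perc_measure :: "nat \<Rightarrow> nat \<Rightarrow> nat \<Rightarrow> real \<Rightarrow> real \<Rightarrow> (edge \<Rightarrow> bool) measure" where
  "perc_measure d l k p q =
     PiM (edges d l k)
       (\<lambda>e. measure_pmf (bernoulli_pmf (if e \<in> edges_of_length d l then p else q)))"

definition open_edges :: "nat \<Rightarrow> nat \<Rightarrow> nat \<Rightarrow> (edge \<Rightarrow> bool) \<Rightarrow> edge set" where
  "open_edges d l k \<omega> = {e \<in> edges d l k. \<omega> e}"

definition root_cluster :: "nat \<Rightarrow> nat \<Rightarrow> nat \<Rightarrow> (edge \<Rightarrow> bool) \<Rightarrow> vertex set" where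
  "root_cluster d l k \<omega> = {w. ([], w) \<in> (open_edges d l k \<omega>)\<^sup>*}"

definition theta :: "nat \<Rightarrow> nat \<Rightarrow> nat \<Rightarrow> real \<Rightarrow> real \<Rightarrow> real" where
  "theta d l k p q =
     measure (perc_measure d l k p q)
       {\<omega> \<in> space (perc_measure d l k p q). infinite (root_cluster d l k \<omega>)}"

text \<open>For \<open>d \<ge> 2\<close> and \<open>l, k \<ge> 1\<close> the infima below are over nonempty sets bounded below by \<open>0\<close>:
  the edges of one length alone percolate once their parameter exceeds \<open>1 / d ^ l\<close>,
  respectively \<open>1 / d ^ k\<close>, which is less than \<open>1\<close>.\<close>

definition p_crit :: "nat \<Rightarrow> nat \<Rightarrow> nat \<Rightarrow> real \<Rightarrow> real" where
  "p_crit d l k q = Inf {p \<in> {0<..<1}. theta d l k p q > 0}"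

definition q_crit :: "nat \<Rightarrow> nat \<Rightarrow> nat \<Rightarrow> real \<Rightarrow> real" where
  "q_crit d l k p = Inf {q \<in> {0<..<1}. theta d l k p q > 0}"

end

(*
A vertex w of the tree is reached with probability b(n), n = |w|, where b(n) is the probability that
n is reached from 0 in the percolation with jumps l and k on the natural numbers. Let
x(n) = d^n b(n) be the mean number of reached vertices of generation n, and let a window be
max l k consecutive integers; no open path jumps over a window.

If theta > 0, then all sums of x over a window are at least theta, and since b is submultiplicative
up to the position in a window, they are in fact at least 1 for windows not containing 0. This
condition is closed, so it holds at the critical point. Raising q to q' then gives
x'(N + k) >= C * (sum over i <= N of x(i) x(N - i)), because for each i an additional k-edge
starting at i can be pivotal, and by the window bound the right-hand side is unbounded. Hence
x'(n) > 1 for some n, which persists for slightly smaller p. Finally x(n) > 1 implies theta > 0: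
the vertices reached in steps of n generations dominate a supercritical branching process.
The second claim is the first one with the roles of l and k exchanged.
*)

theory Submission imports Defs begin

section \<open>Percolation on the natural numbers as a Markov chain of ages\<close>

locale jump_lengths =
  fixes l k :: nat
  assumes l_pos: "1 \<le> l" and k_pos: "1 \<le> k"
begin

text \<open>Percolation on the natural numbers with jumps \<open>l\<close> and \<open>k\<close>, run as a Markov chain: the state
  after \<open>n\<close> steps is the set of all ages \<open>a\<close> such that the integer \<open>n - a\<close> has been reached, so that
  \<open>hit p q n {0}\<close> is the probability that \<open>n\<close> is reached from \<open>0\<close>. A step ages the set \<open>S\<close> to
  \<open>Suc ` S\<close> and inserts \<open>0\<close> with probability \<open>arrival p q S\<close>; \<open>step\<close> is the transition operator
  acting on functions of the state.\<close>

definition arrival :: "real \<Rightarrow> real \<Rightarrow> nat set \<Rightarrow> real" where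
  "arrival p q S = 1 - (1 - p * of_bool (l \<in> Suc ` S)) * (1 - q * of_bool (k \<in> Suc ` S))"

definition step :: "real \<Rightarrow> real \<Rightarrow> (nat set \<Rightarrow> real) \<Rightarrow> nat set \<Rightarrow> real" where
  "step p q f S = arrival p q S * f (insert 0 (Suc ` S)) + (1 - arrival p q S) * f (Suc ` S)"

definition hit :: "real \<Rightarrow> real \<Rightarrow> nat \<Rightarrow> nat set \<Rightarrow> real" where
  "hit p q n = (step p q ^^ n) (\<lambda>S. of_bool (0 \<in> S))"

lemma hit_0 [simp]: "hit p q 0 S = of_bool (0 \<in> S)"
  by (simp add: hit_def)

lemma hit_Suc: "hit p q (Suc n) = step p q (hit p q n)"
  by (simp add: hit_def)

lemma hit_add: "hit p q (m + n) = (step p q ^^ m) (hit p q n)"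
  by (simp add: hit_def funpow_add)

lemma arrival_nonneg: "p \<in> {0..1} \<Longrightarrow> q \<in> {0..1} \<Longrightarrow> 0 \<le> arrival p q S"
  unfolding arrival_def diff_ge_0_iff_ge by (intro mult_le_one) (auto simp: of_bool_def)

lemma arrival_le_1: "p \<in> {0..1} \<Longrightarrow> q \<in> {0..1} \<Longrightarrow> arrival p q S \<le> 1"
  by (auto simp: arrival_def of_bool_def)

lemma arrival_mono:
  assumes "p \<in> {0..1}" "q \<in> {0..1}" "S \<subseteq> S'"
  shows "arrival p q S \<le> arrival p q S'"
  unfolding arrival_def using assms
  by (intro diff_mono mult_mono) (auto simp: of_bool_def)

lemma step_mono:
  assumes "p \<in> {0..1}" "q \<in> {0..1}" "\<And>S. f S \<le> g S"
  shows "step p q f S \<le> step p q g S"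
  unfolding step_def using assms arrival_nonneg arrival_le_1
  by (intro add_mono mult_left_mono) auto

lemma step_funpow_mono:
  assumes "p \<in> {0..1}" "q \<in> {0..1}" "\<And>S. f S \<le> g S"
  shows "(step p q ^^ n) f S \<le> (step p q ^^ n) g S"
  using assms(3) by (induction n arbitrary: S) (auto intro!: step_mono assms)

lemma step_sum:
  "step p q (\<lambda>S. \<Sum>i\<in>I. c i * f i S) S = (\<Sum>i\<in>I. c i * step p q (f i) S)"
  by (simp add: step_def sum_distrib_left sum.distrib sum_subtractf algebra_simps)

lemma step_funpow_sum:
  "(step p q ^^ n) (\<lambda>S. \<Sum>i\<in>I. c i * f i S) = (\<lambda>S. \<Sum>i\<in>I. c i * (step p q ^^ n) (f i) S)"
proof (induction n)
  case (Suc n)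
  then show ?case using step_sum[of p q c "\<lambda>i. (step p q ^^ n) (f i)"] by auto
qed simp

lemma step_diff: "step p q (\<lambda>S. f S - g S) S = step p q f S - step p q g S"
  by (simp add: step_def algebra_simps)

lemma step_scale: "(step p q ^^ n) (\<lambda>S. c * f S) = (\<lambda>S. c * (step p q ^^ n) f S)"
  by (induction n) (simp_all add: step_def algebra_simps fun_eq_iff)

text \<open>A larger state has the larger arrival probability, and an arrival only enlarges the next
  state; an increasing \<open>f\<close> profits from both.\<close>

lemma mono_step:
  assumes pq: "p \<in> {0..1}" "q \<in> {0..1}" and f: "mono f"
  shows "mono (step p q f)"
proof (rule monoI)
  fix S S' :: "nat set" assume sub: "S \<subseteq> S'"
  let ?a = "arrival p q S" and ?b = "arrival p q S'"
  have ab: "?a \<le> ?b" "0 \<le> ?a" "?b \<le> 1" "0 \<le> ?b" "?a \<le> 1"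
    using arrival_mono[OF pq sub] arrival_nonneg[OF pq] arrival_le_1[OF pq] by auto
  have 1: "f (insert 0 (Suc ` S)) \<le> f (insert 0 (Suc ` S'))" "f (Suc ` S) \<le> f (Suc ` S')"
    "f (Suc ` S') \<le> f (insert 0 (Suc ` S'))"
    using sub by (auto intro!: monoD[OF f])
  have "step p q f S \<le> ?a * f (insert 0 (Suc ` S')) + (1 - ?a) * f (Suc ` S')"
    unfolding step_def using 1 ab by (intro add_mono mult_left_mono) auto
  also have "\<dots> = step p q f S' - (?b - ?a) * (f (insert 0 (Suc ` S')) - f (Suc ` S'))"
    by (simp add: step_def algebra_simps)
  also have "\<dots> \<le> step p q f S'" using 1 ab by simp
  finally show "step p q f S \<le> step p q f S'" .
qed

lemma mono_hit: "p \<in> {0..1} \<Longrightarrow> q \<in> {0..1} \<Longrightarrow> mono (hit p q n)"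
proof (induction n)
  case 0
  then show ?case by (auto simp: mono_def of_bool_def)
next
  case (Suc n)
  then show ?case by (simp add: hit_Suc mono_step)
qed

lemma hit_nonneg: "p \<in> {0..1} \<Longrightarrow> q \<in> {0..1} \<Longrightarrow> 0 \<le> hit p q n S"
proof (induction n arbitrary: S)
  case (Suc n)
  then show ?case using arrival_nonneg arrival_le_1
    by (auto simp: hit_Suc step_def)
qed simp

section \<open>Pivotal arrivals and the gain from raising the second parameter\<close>

lemma step_seen_Suc: "step p q (\<lambda>S. of_bool (Suc a \<in> S)) = (\<lambda>S. of_bool (a \<in> S))"
  by (auto simp: step_def fun_eq_iff of_bool_def)

text \<open>Ageing is deterministic: age \<open>a\<close> is present after \<open>i + a\<close>
  steps exactly if age 0 was present after \<open>i\<close> steps. This reads off a past arrival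
  from the current state.\<close>

lemma seen_eq_hit: "(step p q ^^ (i + a)) (\<lambda>S. of_bool (a \<in> S)) = hit p q i"
proof (induction a)
  case (Suc a)
  then show ?case
    by (simp only: add_Suc_right funpow_Suc_right o_def step_seen_Suc)
qed (simp add: hit_def)

text \<open>With \<open>A\<close> and \<open>B\<close> disjoint, the arrivals caused by \<open>A\<close> and by \<open>B\<close> are independent, and
  \<open>B\<close> has to be kept from causing any only until its elements are older than both jumps.\<close>

lemma hit_gap:
  assumes pq: "p \<in> {0..1}" "q \<in> {0..1}" and "A \<inter> B = {}" "\<And>b. b \<in> B \<Longrightarrow> j \<le> b" "1 \<le> j"
  shows "hit p q n (A \<union> B) - hit p q n B \<ge> ((1 - p) * (1 - q)) ^ (max l k - j) * hit p q n A"
  using assms(3-5)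
proof (induction n arbitrary: A B j)
  case 0
  have "((1 - p) * (1 - q)) ^ (max l k - j) \<le> 1"
    using pq by (intro power_le_one) (auto intro: mult_le_one)
  with 0 show ?case by (auto simp: of_bool_def)
next
  case (Suc n)
  let ?r = "(1 - p) * (1 - q)"
  let ?K = "max l k"
  let ?h = "hit p q n"
  have r01: "0 \<le> ?r" "?r \<le> 1" using pq by (auto intro: mult_le_one)
  define a b where "a = arrival p q A" and "b = arrival p q B"
  have ab: "0 \<le> a" "a \<le> 1" "0 \<le> b" "b \<le> 1"
    using arrival_nonneg[OF pq] arrival_le_1[OF pq] by (auto simp: a_def b_def)
  have un: "arrival p q (A \<union> B) = 1 - (1 - a) * (1 - b)"
    using Suc.prems(1) by (auto simp: arrival_def a_def b_def of_bool_def algebra_simps image_iff)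
  \<comment> \<open>One factor \<open>?r\<close> pays for \<open>B\<close> causing no arrival in
    this step. Once \<open>j\<close> reaches \<open>max l k\<close> the set \<open>B\<close> cannot
    cause any, and truncated subtraction makes both exponents 0.\<close>
  have fac: "?r ^ (?K - j) \<le> (1 - b) * ?r ^ (?K - Suc j)"
  proof (cases "j < ?K")
    case True
    have "1 - b \<ge> ?r"
      using pq unfolding b_def arrival_def diff_diff_eq2 add_diff_cancel_left'
      by (intro mult_mono) (auto simp: of_bool_def)
    moreover have "?r ^ (?K - j) = ?r * ?r ^ (?K - Suc j)"
      using True by (metis Suc_diff_Suc power_Suc)
    ultimately show ?thesis using r01 by (simp add: mult_right_mono)
  next
    case False
    then have "l \<notin> Suc ` B" "k \<notin> Suc ` B" using Suc.prems(2) by fastforce+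
    then have "b = 0" by (simp add: b_def arrival_def)
    moreover have "?K - j = 0" "?K - Suc j = 0" using False by auto
    ultimately show ?thesis by simp
  qed
  have IH: "?h (A' \<union> Suc ` B) - ?h (Suc ` B) \<ge> ?r ^ (?K - Suc j) * ?h A'"
    if "A' \<inter> Suc ` B = {}" for A'
    using that Suc.prems by (intro Suc.IH) auto
  have I1: "?h (insert 0 (Suc ` (A \<union> B))) - ?h (Suc ` B) \<ge> ?r ^ (?K - Suc j) * ?h (insert 0 (Suc ` A))"
    using IH[of "insert 0 (Suc ` A)"] Suc.prems by (auto simp: image_Un)
  have I2: "?h (Suc ` (A \<union> B)) - ?h (Suc ` B) \<ge> ?r ^ (?K - Suc j) * ?h (Suc ` A)"
    using IH[of "Suc ` A"] Suc.prems by (auto simp: image_Un)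
  have I3: "?h (insert 0 (Suc ` (A \<union> B))) \<ge> ?h (insert 0 (Suc ` B))"
    by (intro monoD[OF mono_hit[OF pq]]) auto
  have "?r ^ (?K - j) * hit p q (Suc n) A
      \<le> (1 - b) * ?r ^ (?K - Suc j) * hit p q (Suc n) A"
    using fac hit_nonneg[OF pq] by (rule mult_right_mono)
  also have "\<dots> = (1 - b) * a * (?r ^ (?K - Suc j) * ?h (insert 0 (Suc ` A)))
      + (1 - b) * (1 - a) * (?r ^ (?K - Suc j) * ?h (Suc ` A))"
    by (simp add: hit_Suc step_def a_def algebra_simps)
  also have "\<dots> \<le> (1 - b) * a * (?h (insert 0 (Suc ` (A \<union> B))) - ?h (Suc ` B))
      + (1 - b) * (1 - a) * (?h (Suc ` (A \<union> B)) - ?h (Suc ` B))"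
    using ab I1 I2 by (intro add_mono mult_left_mono) auto
  \<comment> \<open>With probability \<open>b\<close> the set \<open>B\<close> itself causes an
    arrival; then 0 is inserted with or without \<open>A\<close>, and this case contributes a
    nonnegative difference.\<close>
  also have "\<dots> \<le> \<dots> + b * (?h (insert 0 (Suc ` (A \<union> B))) - ?h (insert 0 (Suc ` B)))"
    using ab I3 by simp
  also have "\<dots> = hit p q (Suc n) (A \<union> B) - hit p q (Suc n) B"
    unfolding hit_Suc step_def un b_def[symmetric] by (simp add: algebra_simps)
  finally show ?case .
qed

text \<open>Since \<open>hit\<close> is increasing in the state, raising the arrival probability in
  a single step helps; the induction raises it in all steps.\<close>

lemma hit_mono_param:
  assumes p: "p \<in> {0..1}" and q: "q \<in> {0..1}" "q' \<in> {0..1}" "q \<le> q'"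
  shows "hit p q n S \<le> hit p q' n S"
proof (induction n arbitrary: S)
  case (Suc n)
  let ?a = "arrival p q S" and ?b = "arrival p q' S"
  have ab: "?a \<le> ?b" unfolding arrival_def using p q
    by (intro diff_mono mult_left_mono) (auto simp: of_bool_def)
  have 1: "hit p q n (Suc ` S) \<le> hit p q n (insert 0 (Suc ` S))"
    using p q by (intro monoD[OF mono_hit]) auto
  have "hit p q (Suc n) S = step p q' (hit p q n) S
      - (?b - ?a) * (hit p q n (insert 0 (Suc ` S)) - hit p q n (Suc ` S))"
    by (simp add: hit_Suc step_def algebra_simps)
  also have "\<dots> \<le> step p q' (hit p q n) S" using 1 ab by simp
  also have "\<dots> \<le> step p q' (hit p q' n) S" using p q Suc by (intro step_mono) auto
  finally show ?case by (simp add: hit_Suc)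
qed simp

text \<open>Duhamel's formula: the \<open>i\<close>-th summand is the effect of changing the parameter in the \<open>i\<close>-th
  step only.\<close>

lemma hit_duhamel:
  assumes p: "p \<in> {0..1}" and q: "q \<in> {0..1}" "q' \<in> {0..1}"
    and g: "\<And>m S. g m S \<le> step p q' (hit p q m) S - step p q (hit p q m) S"
  shows "(\<Sum>i<n. (step p q' ^^ i) (g (n - 1 - i)) S) \<le> hit p q' n S - hit p q n S"
proof (induction n arbitrary: S)
  case (Suc n)
  \<comment> \<open>The summand for \<open>i = 0\<close> changes the parameter in the first step;
    the others are the induction hypothesis preceded by one step with \<open>q'\<close>.\<close>
  have "(\<Sum>i<Suc n. (step p q' ^^ i) (g (Suc n - 1 - i)) S)
      = g n S + step p q' (\<lambda>S. \<Sum>i<n. (step p q' ^^ i) (g (n - 1 - i)) S) S"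
    using step_sum[of p q' "\<lambda>i. 1" "\<lambda>i. (step p q' ^^ i) (g (n - 1 - i))" "{..<n}" S]
    by (subst sum.lessThan_Suc_shift) (simp add: diff_diff_eq)
  also have "\<dots> \<le> (step p q' (hit p q n) S - step p q (hit p q n) S)
      + step p q' (\<lambda>S. hit p q' n S - hit p q n S) S"
    by (intro add_mono g step_mono p q Suc)
  finally show ?case by (simp add: step_diff hit_Suc)
qed simp

text \<open>For each reached \<open>i\<close>, raising \<open>q\<close> may open the jump from
  \<open>i\<close> to \<open>i + k\<close>. The factor \<open>(q' - q) * (1 - p)\<close> is for this
  jump being newly open with no help from length \<open>l\<close>, and the power, from
  \<open>hit_gap\<close>, is for the other reached integers causing no arrivals afterwards, so that
  the jump is pivotal for reaching \<open>N + k\<close>.\<close>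

lemma hit_sprinkle:
  assumes p: "p \<in> {0..1}" and q: "q \<in> {0..1}" "q' \<in> {0..1}" "q \<le> q'"
  shows "(q' - q) * (1 - p) * ((1 - p) * (1 - q)) ^ (max l k - 1)
      * (\<Sum>i\<le>N. hit p q i {0} * hit p q (N - i) {0}) \<le> hit p q' (N + k) {0}"
proof -
  let ?c = "((1 - p) * (1 - q)) ^ (max l k - 1)"
  let ?C = "(q' - q) * (1 - p) * ?c"
  obtain k0 where k0: "k = Suc k0" using k_pos by (cases k) auto
  have c: "0 \<le> ?c" using p q by auto
  \<comment> \<open>A lower bound for the effect of changing the parameter in one step that is
    followed by \<open>m\<close> more. Age \<open>k0\<close> becomes \<open>k\<close> in that step,
    so \<open>k0 \<in> S\<close> says that a jump of length \<open>k\<close> can arrive.\<close>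
  define g where "g = (\<lambda>m S. ?C * hit p q m {0} * of_bool (k0 \<in> S))"
  have g: "g m S \<le> step p q' (hit p q m) S - step p q (hit p q m) S" for m S
  proof -
    let ?d = "hit p q m (insert 0 (Suc ` S)) - hit p q m (Suc ` S)"
    have d: "?c * hit p q m {0} \<le> ?d"
      using hit_gap[of p q "{0}" "Suc ` S" 1 m] p q by auto
    have a: "(q' - q) * (1 - p) * of_bool (k0 \<in> S) \<le> arrival p q' S - arrival p q S"
    proof -
      have "arrival p q' S - arrival p q S
          = (q' - q) * of_bool (k0 \<in> S) * (1 - p * of_bool (l \<in> Suc ` S))"
        unfolding arrival_def by (auto simp: k0 algebra_simps)
      moreover have "(q' - q) * of_bool (k0 \<in> S) * (1 - p)
          \<le> (q' - q) * of_bool (k0 \<in> S) * (1 - p * of_bool (l \<in> Suc ` S))"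
        using p q by (intro mult_left_mono) (auto simp: of_bool_def)
      ultimately show ?thesis by (simp add: mult_ac)
    qed
    have "g m S = ((q' - q) * (1 - p) * of_bool (k0 \<in> S)) * (?c * hit p q m {0})"
      by (simp add: g_def)
    also have "\<dots> \<le> (arrival p q' S - arrival p q S) * ?d"
    proof (rule mult_mono)
      have "0 \<le> (q' - q) * (1 - p) * of_bool (k0 \<in> S)" using p q by simp
      then show "0 \<le> arrival p q' S - arrival p q S" using a by linarith
    qed (use a d c p q hit_nonneg[of p q] in auto)
    finally show ?thesis by (simp add: step_def algebra_simps)
  qed
  have "?C * (\<Sum>i\<le>N. hit p q i {0} * hit p q (N - i) {0})
      = (\<Sum>i\<le>N. (hit p q i {0}) * (?C * hit p q (N - i) {0}))"
    by (simp add: sum_distrib_left mult_ac)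
  also have "\<dots> \<le> (\<Sum>i\<le>N. (hit p q' i {0}) * (?C * hit p q (N - i) {0}))"
    using p q hit_nonneg[of p q] c
    by (intro sum_mono mult_right_mono hit_mono_param) auto
  \<comment> \<open>The jump from \<open>i\<close> arrives in the step with index
    \<open>i + k0\<close>, which leaves \<open>N + k - 1 - (i + k0) = N - i\<close> steps.\<close>
  also have "\<dots> = (\<Sum>i\<le>N. (step p q' ^^ (i + k0)) (g (N - i)) {0})"
    unfolding g_def step_scale seen_eq_hit by (simp add: mult_ac)
  also have "\<dots> = (\<Sum>i\<in>(\<lambda>i. i + k0) ` {..N}. (step p q' ^^ i) (g (N + k - 1 - i)) {0})"
    by (subst sum.reindex) (auto simp: k0 inj_on_def)
  \<comment> \<open>The summands added here are those with index below \<open>k0\<close>.\<close>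
  also have "\<dots> \<le> (\<Sum>i<N + k. (step p q' ^^ i) (g (N + k - 1 - i)) {0})"
  proof (intro sum_mono2)
    fix i
    have "0 \<le> g m S" for m S using p q c hit_nonneg[of p q] by (simp add: g_def)
    then have "(step p q' ^^ i) (\<lambda>S. 0 * of_bool (0 \<in> S)) {0} \<le> (step p q' ^^ i) (g (N + k - 1 - i)) {0}"
      by (intro step_funpow_mono p q) auto
    then show "0 \<le> (step p q' ^^ i) (g (N + k - 1 - i)) {0}" by (simp only: step_scale)
  qed (auto simp: k0)
  also have "\<dots> \<le> hit p q' (N + k) {0} - hit p q (N + k) {0}"
    by (rule hit_duhamel[OF p q(1,2) g])
  also have "\<dots> \<le> hit p q' (N + k) {0}" using hit_nonneg[OF p q(1)] by simp
  finally show ?thesis .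
qed

section \<open>Subadditivity in the state and submultiplicativity up to a window\<close>

lemma step_ge_mono:
  assumes pq: "p \<in> {0..1}" "q \<in> {0..1}" and f: "mono f"
  shows "f (Suc ` S) \<le> step p q f S"
proof -
  have "step p q f S = f (Suc ` S) + arrival p q S * (f (insert 0 (Suc ` S)) - f (Suc ` S))"
    by (simp add: step_def algebra_simps)
  moreover have "f (Suc ` S) \<le> f (insert 0 (Suc ` S))" by (intro monoD[OF f]) auto
  ultimately show ?thesis using arrival_nonneg[OF pq, of S] by simp
qed

text \<open>Run the chains from \<open>S\<close> and \<open>T\<close> independently, with arrival
  probabilities \<open>a\<close> and \<open>b\<close>. At least one has an arrival with probability
  \<open>1 - (1 - a) * (1 - b)\<close>, which is no less than for the union, because jumps from
  common ages are tried twice.\<close>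

lemma hit_Un:
  assumes pq: "p \<in> {0..1}" "q \<in> {0..1}"
  shows "hit p q n (S \<union> T) \<le> hit p q n S + hit p q n T"
proof (induction n arbitrary: S T)
  case (Suc n)
  let ?h = "hit p q n"
  let ?i = "\<lambda>S. insert 0 (Suc ` S)" and ?s = "\<lambda>S. Suc ` S"
  define a b c where "a = arrival p q S" and "b = arrival p q T" and "c = arrival p q (S \<union> T)"
  have r: "0 \<le> a" "a \<le> 1" "0 \<le> b" "b \<le> 1"
    using arrival_nonneg[OF pq] arrival_le_1[OF pq] by (auto simp: a_def b_def)
  have c: "c \<le> 1 - (1 - a) * (1 - b)"
  proof -
    have *: "(1 - p * x) * (1 - q * y) * ((1 - p * x') * (1 - q * y'))
        \<le> (1 - p * max x x') * (1 - q * max y y')"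
      if "x \<in> {0,1}" "y \<in> {0,1}" "x' \<in> {0,1}" "y' \<in> {0,1}" for x y x' y' :: real
    proof -
      have "(1 - p) * (1 - p) \<le> 1 - p" "(1 - q) * (1 - q) \<le> 1 - q"
        using pq by (auto intro!: mult_left_le)
      then have "(1 - p * x) * (1 - p * x') \<le> 1 - p * max x x'"
          "(1 - q * y) * (1 - q * y') \<le> 1 - q * max y y'"
        using that by auto
      moreover have "0 \<le> (1 - q * y) * (1 - q * y')" "0 \<le> 1 - p * max x x'"
        using that pq by auto
      ultimately have "((1 - p * x) * (1 - p * x')) * ((1 - q * y) * (1 - q * y'))
          \<le> (1 - p * max x x') * (1 - q * max y y')"
        by (intro mult_mono) auto
      then show ?thesis by (simp add: mult_ac)
    qed
    have m: "of_bool (x \<in> Suc ` (S \<union> T)) = (max (of_bool (x \<in> Suc ` S)) (of_bool (x \<in> Suc ` T)) :: real)" for x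
      by (auto simp: of_bool_def)
    show ?thesis unfolding a_def b_def c_def arrival_def m
      using *[of "of_bool (l \<in> Suc ` S)" "of_bool (k \<in> Suc ` S)" "of_bool (l \<in> Suc ` T)" "of_bool (k \<in> Suc ` T)"]
      by (auto simp: of_bool_def)
  qed
  have m: "?h (?s (S \<union> T)) \<le> ?h (?i (S \<union> T))" by (intro monoD[OF mono_hit[OF pq]]) auto
  have I1: "?h (?i (S \<union> T)) \<le> ?h (?i S) + ?h (?i T)" using Suc.IH[of "?i S" "?i T"] by (simp add: image_Un)
  have I2: "?h (?i (S \<union> T)) \<le> ?h (?i S) + ?h (?s T)" using Suc.IH[of "?i S" "?s T"] by (simp add: image_Un)
  have I3: "?h (?i (S \<union> T)) \<le> ?h (?s S) + ?h (?i T)" using Suc.IH[of "?s S" "?i T"] by (simp add: image_Un)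
  have I4: "?h (?s (S \<union> T)) \<le> ?h (?s S) + ?h (?s T)" using Suc.IH[of "?s S" "?s T"] by (simp add: image_Un)
  have "hit p q (Suc n) (S \<union> T) = ?h (?s (S \<union> T)) + c * (?h (?i (S \<union> T)) - ?h (?s (S \<union> T)))"
    by (simp add: hit_Suc step_def c_def algebra_simps)
  also have "\<dots> \<le> ?h (?s (S \<union> T)) + (1 - (1 - a) * (1 - b)) * (?h (?i (S \<union> T)) - ?h (?s (S \<union> T)))"
    using c m by (intro add_left_mono mult_right_mono) auto
  \<comment> \<open>The cases are: both chains have an arrival, only the one from \<open>S\<close>,
    only the one from \<open>T\<close>, neither.\<close>
  also have "\<dots> = a * b * ?h (?i (S \<union> T)) + a * (1 - b) * ?h (?i (S \<union> T))
      + (1 - a) * b * ?h (?i (S \<union> T)) + (1 - a) * (1 - b) * ?h (?s (S \<union> T))"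
    by (simp add: algebra_simps)
  also have "\<dots> \<le> a * b * (?h (?i S) + ?h (?i T)) + a * (1 - b) * (?h (?i S) + ?h (?s T))
      + (1 - a) * b * (?h (?s S) + ?h (?i T)) + (1 - a) * (1 - b) * (?h (?s S) + ?h (?s T))"
    using r I1 I2 I3 I4 by (intro add_mono mult_left_mono) auto
  also have "\<dots> = hit p q (Suc n) S + hit p q (Suc n) T"
    by (simp add: hit_Suc step_def a_def[symmetric] b_def[symmetric] algebra_simps)
  finally show ?case .
qed simp

text \<open>In the next step such ages already exceed both jump lengths, and ageing keeps it so;
  hence no arrival ever occurs.\<close>

lemma hit_old: "(\<And>s. s \<in> S \<Longrightarrow> max l k \<le> s) \<Longrightarrow> hit p q n S = 0"
proof (induction n arbitrary: S)
  case 0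
  then show ?case using l_pos by fastforce
next
  case (Suc n)
  have "l \<notin> Suc ` S" "k \<notin> Suc ` S" using Suc.prems by fastforce+
  then have "arrival p q S = 0" by (simp add: arrival_def)
  moreover have "hit p q n (Suc ` S) = 0" using Suc.prems by (intro Suc.IH) (auto intro: le_SucI)
  ultimately show ?case by (simp add: hit_Suc step_def)
qed

text \<open>Ageing \<open>{0}\<close> for \<open>a\<close> steps without arrivals gives
  \<open>{a}\<close>, and arrivals can only help.\<close>

lemma hit_singleton_le:
  assumes pq: "p \<in> {0..1}" "q \<in> {0..1}"
  shows "hit p q n {a} \<le> hit p q (a + n) {0}"
proof (induction a arbitrary: n)
  case (Suc a)
  have "hit p q n {Suc a} \<le> hit p q (Suc n) {a}"
    using step_ge_mono[OF pq mono_hit[OF pq, of n], of "{a}"] by (simp add: hit_Suc)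
  also have "\<dots> \<le> hit p q (Suc a + n) {0}" using Suc[of "Suc n"] by simp
  finally show ?case .
qed simp

lemma hit_le_sum:
  assumes pq: "p \<in> {0..1}" "q \<in> {0..1}"
  shows "hit p q n S \<le> (\<Sum>a<max l k. of_bool (a \<in> S) * hit p q (a + n) {0})"
proof -
  have fin: "hit p q n F \<le> (\<Sum>a\<in>F. hit p q n {a})" if "finite F" for F
    using that
  proof induction
    case empty
    then show ?case using hit_old[of "{}"] by simp
  next
    case (insert x F)
    then show ?case using hit_Un[OF pq, of n "{x}" F] by simp
  qed
  let ?K = "max l k"
  have "hit p q n S \<le> hit p q n (S \<inter> {..<?K}) + hit p q n (S - {..<?K})"
    using hit_Un[OF pq, of n "S \<inter> {..<?K}" "S - {..<?K}"] by (simp add: Int_Diff_Un)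
  also have "hit p q n (S - {..<?K}) = 0" by (intro hit_old) auto
  also have "hit p q n (S \<inter> {..<?K}) \<le> (\<Sum>a\<in>S \<inter> {..<?K}. hit p q n {a})" by (intro fin) auto
  also have "\<dots> = (\<Sum>a<?K. of_bool (a \<in> S) * hit p q n {a})"
    by (intro sum.mono_neutral_cong_left) auto
  also have "\<dots> \<le> (\<Sum>a<?K. of_bool (a \<in> S) * hit p q (a + n) {0})"
    by (intro sum_mono mult_left_mono hit_singleton_le pq) auto
  finally show ?thesis by simp
qed

text \<open>The future after time \<open>M\<close> depends on the state only through ages
  \<open>a < max l k\<close>, that is, on which integers \<open>M - a\<close> of the last window
  were reached; from \<open>M - a\<close> there remains the distance \<open>a + n\<close>. The
  assumption on \<open>M\<close> makes the whole window consist of natural numbers.\<close>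

lemma hit_submult:
  assumes pq: "p \<in> {0..1}" "q \<in> {0..1}" and M: "max l k \<le> Suc M"
  shows "hit p q (M + n) {0} \<le> (\<Sum>a<max l k. hit p q (M - a) {0} * hit p q (a + n) {0})"
proof -
  have "hit p q (M + n) {0}
      \<le> (step p q ^^ M) (\<lambda>S. \<Sum>a<max l k. hit p q (a + n) {0} * of_bool (a \<in> S)) {0}"
    unfolding hit_add[of p q M n] using hit_le_sum[OF pq, of n]
    by (intro step_funpow_mono pq) (simp add: mult.commute)
  also have "\<dots> = (\<Sum>a<max l k. hit p q (a + n) {0} * hit p q (M - a) {0})"
    unfolding step_funpow_sum
  proof (intro sum.cong refl arg_cong2[where f = "(*)"])
    fix a assume "a \<in> {..<max l k}"
    then have "M = (M - a) + a" using M by auto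
    then show "(step p q ^^ M) (\<lambda>S. of_bool (a \<in> S)) {0} = hit p q (M - a) {0}"
      by (metis seen_eq_hit)
  qed
  finally show ?thesis by (simp add: mult.commute)
qed

text \<open>The single jump from 0 to \<open>l\<close> suffices. This later shows that the set
  defining the critical parameter is nonempty.\<close>

lemma hit_l_ge:
  assumes "p \<in> {0..1}" "q \<in> {0..1}"
  shows "p \<le> hit p q l {0}"
proof -
  have arr: "p * of_bool (l - 1 \<in> S) \<le> arrival p q S" for S
  proof -
    have "l \<in> Suc ` S" if "l - 1 \<in> S" using that l_pos by (intro image_eqI[of _ _ "l - 1"]) auto
    then show ?thesis using assms
      by (auto simp: arrival_def of_bool_def algebra_simps mult_left_le_one_le)
  qed
  have "p = p * hit p q 0 {0}" by simp
  also have "\<dots> = (step p q ^^ (l - 1)) (\<lambda>S. p * of_bool (l - 1 \<in> S)) {0}"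
    using seen_eq_hit[where p = p and q = q and i = 0 and a = "l - 1"] by (simp add: step_scale)
  also have "\<dots> \<le> (step p q ^^ (l - 1)) (hit p q 1) {0}"
    using assms arr by (intro step_funpow_mono) (auto simp: hit_Suc step_def)
  also have "\<dots> = hit p q l {0}" using hit_add[of p q "l - 1" 1] l_pos by simp
  finally show ?thesis .
qed

text \<open>For fixed \<open>n\<close> and \<open>S\<close>, \<open>hit\<close> is a polynomial in
  its two parameters.\<close>

lemma continuous_on_hit [continuous_intros]:
  assumes "continuous_on A f" "continuous_on A g"
  shows "continuous_on A (\<lambda>x. hit (f x) (g x) n S)"
proof (induction n arbitrary: S)
  case (Suc n)
  then show ?case unfolding hit_Suc step_def arrival_def
    by (intro continuous_intros assms)
qed simp

end

section \<open>Two facts about nonnegative sequences\<close>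

text \<open>If the window at \<open>N\<close> had a sum \<open>A < 1\<close>, submultiplicativity
  would bound each later value by \<open>A\<close> times a bound for the values shortly before it.
  The sequence would decay geometrically, contradicting the uniform lower bound
  \<open>\<theta>\<close>.\<close>

lemma window_sum_ge_1:
  fixes x :: "nat \<Rightarrow> real"
  assumes nonneg: "\<And>n. 0 \<le> x n" and K: "1 \<le> K"
    and submult: "\<And>M n. K \<le> Suc M \<Longrightarrow> x (M + n) \<le> (\<Sum>a<K. x (M - a) * x (a + n))"
    and pos: "0 < \<theta>" "\<And>n. \<theta> \<le> (\<Sum>a<K. x (n + a))" and N: "1 \<le> N"
  shows "1 \<le> (\<Sum>a<K. x (N + a))"
proof (rule ccontr)
  define A where "A = (\<Sum>a<K. x (N + a))"
  assume "\<not> ?thesis"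
  then have A: "A < 1" "0 \<le> A" by (auto simp: A_def nonneg sum_nonneg)
  have shrink: "x n \<le> A * c" if "N + K \<le> Suc n" "\<And>m. n < m + (N + K) \<Longrightarrow> m < n \<Longrightarrow> x m \<le> c" for n c
  proof -
    \<comment> \<open>The window at \<open>N\<close> ends at \<open>N + K - 1\<close>, and
      \<open>n\<close> lies \<open>i\<close> beyond that. As \<open>1 \<le> N\<close>, the indices
      \<open>a + i\<close> with \<open>a < K\<close> stay strictly below \<open>n\<close>.\<close>
    define i where "i = n - (N + K - 1)"
    have i: "n = (N + K - 1) + i" using that K N by (simp add: i_def)
    have "x n \<le> (\<Sum>a<K. x (N + K - 1 - a) * x (a + i))"
      unfolding i using K N by (intro submult) auto
    also have "\<dots> \<le> (\<Sum>a<K. x (N + K - 1 - a) * c)"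
      using N K by (intro sum_mono mult_left_mono that nonneg) (auto simp: i)
    also have "\<dots> = (\<Sum>a<K. x (N + a)) * c"
      unfolding sum_distrib_right
      by (rule sum.reindex_bij_witness[of _ "\<lambda>a. K - 1 - a" "\<lambda>a. K - 1 - a"]) auto
    finally show ?thesis by (simp add: A_def)
  qed
  define B where "B = (\<Sum>i<N + K. x i)"
  have B: "x n \<le> B" for n
  proof (induction n rule: less_induct)
    case (less n)
    have "0 \<le> B" by (auto simp: B_def nonneg sum_nonneg)
    show ?case
    proof (cases "n < N + K")
      case True
      then show ?thesis unfolding B_def by (intro member_le_sum) (auto simp: nonneg)
    next
      case False
      then have "x n \<le> A * B" by (intro shrink less) auto
      then show ?thesis using A \<open>0 \<le> B\<close> mult_right_mono[of A 1 B] by simp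
    qed
  qed
  \<comment> \<open>The values used by \<open>shrink\<close> lie less than \<open>N + K\<close>
    before \<open>n\<close>, so every stretch of \<open>N + K\<close> indices yields one more factor
    \<open>A\<close>.\<close>
  have decay: "x n \<le> A ^ t * B" if "t * (N + K) \<le> n" for t n
    using that
  proof (induction t arbitrary: n)
    case (Suc t)
    have "x n \<le> A * (A ^ t * B)" using Suc.prems by (intro shrink Suc.IH) auto
    then show ?case by simp
  qed (use B in auto)
  have "(\<lambda>t. real K * (A ^ t * B)) \<longlonglongrightarrow> real K * (0 * B)"
    using A by (intro tendsto_intros LIMSEQ_realpow_zero) auto
  then have "\<forall>\<^sub>F t in sequentially. real K * (A ^ t * B) < \<theta>"
    using pos(1) by (intro order_tendstoD) auto
  then obtain t where t: "real K * (A ^ t * B) < \<theta>" by (auto simp: eventually_sequentially)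
  have "(\<Sum>a<K. x (t * (N + K) + a)) \<le> (\<Sum>a<K. A ^ t * B)"
    by (intro sum_mono decay) auto
  then show False using pos(2)[of "t * (N + K)"] t by simp
qed

text \<open>Multiplying \<open>R\<close> pairs of opposite windows gives a total of at least
  \<open>R\<close>. For fixed offsets \<open>a\<close> and \<open>b\<close> in the two windows, the
  products all belong to one convolution sum, so \<open>y \<le> 1\<close> would bound the total by
  \<open>K * K / C\<close>.\<close>

lemma convolution_unbounded:
  fixes x y :: "nat \<Rightarrow> real"
  assumes nonneg: "\<And>n. 0 \<le> x n" and window: "\<And>N. 1 \<le> N \<Longrightarrow> 1 \<le> (\<Sum>a<K. x (N + a))"
    and C: "0 < C" and conv: "\<And>N. C * (\<Sum>i\<le>N. x i * x (N - i)) \<le> y N"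
  shows "\<exists>N. 1 < y N"
proof (rule ccontr)
  assume "\<not> ?thesis"
  then have y: "y N \<le> 1" for N by (simp add: not_less)
  obtain R :: nat where R: "real R > real K * real K / C" using reals_Archimedean2 by blast
  have "real R = (\<Sum>r<R. 1 * 1)" by simp
  \<comment> \<open>The offset 1 keeps both windows away from index 0, where the window bound is not
    assumed.\<close>
  also have "\<dots> \<le> (\<Sum>r<R. (\<Sum>a<K. x (1 + r * K + a)) * (\<Sum>b<K. x (1 + (R - r) * K + b)))"
    using nonneg by (intro sum_mono mult_mono window sum_nonneg) auto
  also have "\<dots> = (\<Sum>a<K. \<Sum>b<K. \<Sum>r<R. x (1 + r * K + a) * x (1 + (R - r) * K + b))"
    unfolding sum_product sum.swap[of _ "{..<K}" "{..<R}"]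
    by (rule refl)
  also have "\<dots> \<le> (\<Sum>a<K. \<Sum>b<K. 1 / C)"
  proof (intro sum_mono)
    fix a b assume "a \<in> {..<K}" "b \<in> {..<K}"
    then have K: "0 < K" by auto
    \<comment> \<open>The two indices in each product add up to \<open>?N\<close>, whatever
      \<open>r\<close> is.\<close>
    let ?N = "2 + R * K + a + b"
    have "(\<Sum>r<R. x (1 + r * K + a) * x (1 + (R - r) * K + b))
        = (\<Sum>i\<in>(\<lambda>r. 1 + r * K + a) ` {..<R}. x i * x (?N - i))"
    proof (subst sum.reindex)
      show "inj_on (\<lambda>r. 1 + r * K + a) {..<R}" using K by (auto simp: inj_on_def)
      have "2 + R * K + a + b - (1 + r * K + a) = 1 + (R - r) * K + b" if "r < R" for r
      proof -
        have "R * K = r * K + (R - r) * K" using that by (simp add: add_mult_distrib[symmetric])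
        then show ?thesis by simp
      qed
      then show "(\<Sum>r<R. x (1 + r * K + a) * x (1 + (R - r) * K + b))
          = sum ((\<lambda>i. x i * x (?N - i)) \<circ> (\<lambda>r. 1 + r * K + a)) {..<R}"
        by (intro sum.cong) auto
    qed
    also have "\<dots> \<le> (\<Sum>i\<le>?N. x i * x (?N - i))"
    proof (intro sum_mono2)
      show "(\<lambda>r. 1 + r * K + a) ` {..<R} \<subseteq> {..?N}"
      proof safe
        fix r assume "r < R"
        then have "r * K \<le> R * K" by simp
        then show "1 + r * K + a \<le> ?N" by linarith
      qed
    qed (auto simp: nonneg)
    also have "\<dots> \<le> 1 / C"
      using conv[of ?N] y[of ?N] C by (simp add: pos_le_divide_eq mult.commute)
    finally show "(\<Sum>r<R. x (1 + r * K + a) * x (1 + (R - r) * K + b)) \<le> 1 / C" .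
  qed
  finally show False using R by simp
qed

section \<open>Passing strictly below the critical point\<close>

text \<open>The bound \<open>\<theta>\<close> in \<open>win\<close> may vanish as \<open>n\<close>
  grows, but \<open>window_sum_ge_1\<close> replaces it by 1, which survives the limit. Sprinkling
  at \<open>p\<^sub>0\<close> then gives a mean above 1, and continuity leaves room to lower
  \<open>p\<close>.\<close>

lemma (in jump_lengths) mean_hits_gt_1_below:
  fixes d p\<^sub>0 q q' :: real
  assumes p\<^sub>0: "0 < p\<^sub>0" "p\<^sub>0 < 1" and q: "q \<in> {0..1}" "q' \<in> {0..1}" "q < q'" and d: "1 \<le> d"
    and P: "\<And>n. P n \<in> {0..1}" "P \<longlonglongrightarrow> p\<^sub>0"
    and win: "\<And>n. \<exists>\<theta>>0. \<forall>N. \<theta> \<le> (\<Sum>a<max l k. d ^ (N + a) * hit (P n) q (N + a) {0})"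
  shows "\<exists>p\<in>{0<..<p\<^sub>0}. \<exists>n. 1 < d ^ n * hit p q' n {0}"
proof -
  have ge1: "1 \<le> (\<Sum>a<max l k. d ^ (N + a) * hit (P n) q (N + a) {0})" if "1 \<le> N" for n N
  proof -
    obtain \<theta> where th: "0 < \<theta>" "\<And>N. \<theta> \<le> (\<Sum>a<max l k. d ^ (N + a) * hit (P n) q (N + a) {0})"
      using win by blast
    show ?thesis
    proof (rule window_sum_ge_1[where x = "\<lambda>i. d ^ i * hit (P n) q i {0}", OF _ _ _ th that])
      fix M m assume M: "max l k \<le> Suc M"
      have "d ^ (M + m) * hit (P n) q (M + m) {0}
          \<le> d ^ (M + m) * (\<Sum>a<max l k. hit (P n) q (M - a) {0} * hit (P n) q (a + m) {0})"
        using d by (intro mult_left_mono hit_submult P q M) auto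
      also have "\<dots> = (\<Sum>a<max l k. d ^ (M - a) * hit (P n) q (M - a) {0} *
          (d ^ (a + m) * hit (P n) q (a + m) {0}))"
        unfolding sum_distrib_left
      proof (intro sum.cong refl)
        fix a assume "a \<in> {..<max l k}"
        then have "M + m = (M - a) + (a + m)" using M by auto
        then have "d ^ (M + m) = d ^ (M - a) * d ^ (a + m)" by (metis power_add)
        then show "d ^ (M + m) * (hit (P n) q (M - a) {0} * hit (P n) q (a + m) {0}) =
            d ^ (M - a) * hit (P n) q (M - a) {0} * (d ^ (a + m) * hit (P n) q (a + m) {0})"
          by simp
      qed
      finally show "d ^ (M + m) * hit (P n) q (M + m) {0} \<le> \<dots>" .
    qed (use d P q l_pos hit_nonneg in auto)
  qed
  have cont: "isCont (\<lambda>p. hit p r n {0}) p" for p r n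
    using continuous_on_hit[of UNIV "\<lambda>p. p" "\<lambda>_. r"]
    by (simp add: continuous_on_eq_continuous_at)
  have win0: "1 \<le> (\<Sum>a<max l k. d ^ (N + a) * hit p\<^sub>0 q (N + a) {0})" if "1 \<le> N" for N
  proof (rule tendsto_lowerbound[OF _ _ sequentially_bot])
    show "(\<lambda>n. \<Sum>a<max l k. d ^ (N + a) * hit (P n) q (N + a) {0})
        \<longlonglongrightarrow> (\<Sum>a<max l k. d ^ (N + a) * hit p\<^sub>0 q (N + a) {0})"
      by (intro tendsto_intros isCont_tendsto_compose[OF cont] P)
    show "\<forall>\<^sub>F n in sequentially. 1 \<le> (\<Sum>a<max l k. d ^ (N + a) * hit (P n) q (N + a) {0})"
      using ge1[OF that] by simp
  qed
  define C where "C = (q' - q) * (1 - p\<^sub>0) * ((1 - p\<^sub>0) * (1 - q)) ^ (max l k - 1)"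
  have C: "0 < C" using p\<^sub>0 q by (auto simp: C_def)
  have "\<exists>N. 1 < d ^ (N + k) * hit p\<^sub>0 q' (N + k) {0}"
  proof (rule convolution_unbounded[where x = "\<lambda>n. d ^ n * hit p\<^sub>0 q n {0}" and K = "max l k", OF _ win0 C])
    fix N
    have "C * (\<Sum>i\<le>N. d ^ i * hit p\<^sub>0 q i {0} * (d ^ (N - i) * hit p\<^sub>0 q (N - i) {0}))
        = d ^ N * (C * (\<Sum>i\<le>N. hit p\<^sub>0 q i {0} * hit p\<^sub>0 q (N - i) {0}))"
      unfolding sum_distrib_left
    proof (intro sum.cong refl)
      fix i assume "i \<in> {..N}"
      then have "d ^ N = d ^ i * d ^ (N - i)" by (simp add: power_add[symmetric])
      then show "C * (d ^ i * hit p\<^sub>0 q i {0} * (d ^ (N - i) * hit p\<^sub>0 q (N - i) {0})) =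
          d ^ N * (C * (hit p\<^sub>0 q i {0} * hit p\<^sub>0 q (N - i) {0}))" by simp
    qed
    also have "\<dots> \<le> d ^ N * hit p\<^sub>0 q' (N + k) {0}"
      unfolding C_def using d p\<^sub>0 q by (intro mult_left_mono hit_sprinkle) auto
    also have "\<dots> \<le> d ^ (N + k) * hit p\<^sub>0 q' (N + k) {0}"
      using d p\<^sub>0 q by (intro mult_right_mono power_increasing hit_nonneg) auto
    finally show "C * (\<Sum>i\<le>N. d ^ i * hit p\<^sub>0 q i {0} * (d ^ (N - i) * hit p\<^sub>0 q (N - i) {0})) \<le> \<dots>" .
  qed (use d p\<^sub>0 q hit_nonneg in auto)
  then obtain n where n: "1 < d ^ n * hit p\<^sub>0 q' n {0}" by blast
  have "((\<lambda>p. d ^ n * hit p q' n {0}) \<longlongrightarrow> d ^ n * hit p\<^sub>0 q' n {0}) (at_left p\<^sub>0)"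
    using cont[where r = q' and p = p\<^sub>0] by (intro tendsto_intros) (auto simp: isCont_def filterlim_at_split)
  then have "\<forall>\<^sub>F p in at_left p\<^sub>0. 1 < d ^ n * hit p q' n {0}"
    by (rule order_tendstoD) (rule n)
  moreover have "\<forall>\<^sub>F p in at_left p\<^sub>0. p \<in> {0<..<p\<^sub>0}"
    using p\<^sub>0 by (intro eventually_at_leftI) auto
  ultimately have "\<forall>\<^sub>F p in at_left p\<^sub>0. p \<in> {0<..<p\<^sub>0} \<and> 1 < d ^ n * hit p q' n {0}"
    by (rule eventually_conj[rotated])
  then show ?thesis
    by (metis (mono_tags, lifting) eventually_happens' trivial_limit_at_left_real)
qed

section \<open>Independence in product spaces and a Bonferroni bound\<close>

text \<open>Filling the coordinates outside \<open>J\<close> from a fixed point \<open>w\<close>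
  does not change \<open>P\<close>, and likewise for \<open>L\<close> and \<open>Q\<close>. Both
  events thereby become functions of restrictions to disjoint sets of independent
  coordinates.\<close>

lemma prob_conj_disjoint_coordinates:
  fixes I :: "'i set" and N :: "'i \<Rightarrow> 'a measure"
  defines "M \<equiv> PiM I N"
  assumes N: "\<And>i. i \<in> I \<Longrightarrow> prob_space (N i)"
    and JL: "J \<subseteq> I" "L \<subseteq> I" "J \<inter> L = {}"
    and sets: "Measurable.pred M P" "Measurable.pred M Q"
    and P: "\<And>\<omega> \<omega>'. \<omega> \<in> space M \<Longrightarrow> \<omega>' \<in> space M \<Longrightarrow> (\<And>i. i \<in> J \<Longrightarrow> \<omega> i = \<omega>' i) \<Longrightarrow> P \<omega> = P \<omega>'"
    and Q: "\<And>\<omega> \<omega>'. \<omega> \<in> space M \<Longrightarrow> \<omega>' \<in> space M \<Longrightarrow> (\<And>i. i \<in> L \<Longrightarrow> \<omega> i = \<omega>' i) \<Longrightarrow> Q \<omega> = Q \<omega>'"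
  shows "\<P>(\<omega> in M. P \<omega> \<and> Q \<omega>) = \<P>(\<omega> in M. P \<omega>) * \<P>(\<omega> in M. Q \<omega>)"
proof -
  interpret prob_space M unfolding M_def by (intro prob_space_PiM N)
  obtain w where w: "w \<in> space M" using not_empty by blast
  define ext where "ext = (\<lambda>J x. \<lambda>i\<in>I. if i \<in> J then x i else w i)"
  have ext: "ext K \<in> measurable (PiM K N) M" if "K \<subseteq> I" for K
    unfolding ext_def M_def
  proof (rule measurable_restrict)
    fix i assume "i \<in> I"
    then show "(\<lambda>x. if i \<in> K then x i else w i) \<in> measurable (PiM K N) (N i)"
      using w by (cases "i \<in> K") (auto simp: M_def space_PiM intro!: measurable_const)
  qed
  have ext_space: "ext K \<omega> \<in> space M" if "\<omega> \<in> space M" for K \<omega>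
    using that w by (auto simp: ext_def M_def space_PiM PiE_iff)
  have ext_restrict: "ext K (restrict \<omega> K) = ext K \<omega>" for K \<omega> by (auto simp: ext_def)
  have indep: "indep_vars N (\<lambda>i \<omega>. \<omega> i) I"
  proof (cases "I = {}")
    case True
    then show ?thesis by (simp add: indep_vars_def2 indep_sets_def)
  next
    case False
    have "distr M (PiM I N) (\<lambda>x. \<lambda>i\<in>I. x i) = distr M M (\<lambda>x. x)"
      unfolding M_def by (intro distr_cong refl) (auto simp: space_PiM)
    also have "\<dots> = (\<Pi>\<^sub>M i\<in>I. distr M (N i) (\<lambda>\<omega>. \<omega> i))"
      unfolding distr_id unfolding M_def by (intro PiM_cong refl distr_PiM_component[symmetric] N)
    finally show ?thesis
      using False by (subst indep_vars_iff_distr_eq_PiM') (auto simp: M_def)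
  qed
  have "indep_var M (ext J \<circ> (\<lambda>\<omega>. restrict \<omega> J)) M (ext L \<circ> (\<lambda>\<omega>. restrict \<omega> L))"
    using indep_var_restrict[OF indep, of J L] JL
    by (intro indep_var_compose[where ?M1.0 = "PiM J N" and ?M2.0 = "PiM L N"] ext) auto
  then have "indep_var M (ext J) M (ext L)" by (simp add: o_def ext_restrict)
  from indep_varD[OF this predE[OF sets(1)] predE[OF sets(2)]]
  have "prob {\<omega> \<in> space M. P (ext J \<omega>) \<and> Q (ext L \<omega>)}
      = prob {\<omega> \<in> space M. P (ext J \<omega>)} * prob {\<omega> \<in> space M. Q (ext L \<omega>)}"
    using ext_space by (simp add: vimage_def Int_def conj_ac cong: conj_cong)
  moreover have "P (ext J \<omega>) = P \<omega>" if "\<omega> \<in> space M" for \<omega>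
    using that JL by (intro P ext_space) (auto simp: ext_def)
  moreover have "Q (ext L \<omega>) = Q \<omega>" if "\<omega> \<in> space M" for \<omega>
    using that JL by (intro Q ext_space) (auto simp: ext_def)
  ultimately show ?thesis by (simp cong: conj_cong)
qed

text \<open>A crude second Bonferroni inequality: a new event overlaps the union of the earlier ones
  by at most \<open>card F * c\<close>, less than the growth of the square.\<close>

lemma (in prob_space) prob_UN_ge:
  assumes "finite F" "\<And>i. i \<in> F \<Longrightarrow> A i \<in> events"
    and c: "\<And>i j. i \<in> F \<Longrightarrow> j \<in> F \<Longrightarrow> i \<noteq> j \<Longrightarrow> prob (A i \<inter> A j) \<le> c" "0 \<le> c"
  shows "(\<Sum>i\<in>F. prob (A i)) - (real (card F))\<^sup>2 * c \<le> prob (\<Union>i\<in>F. A i)"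
  using assms(1,2,3)
proof (induction F rule: finite_induct)
  case (insert x F)
  let ?U = "\<Union>i\<in>F. A i"
  have meas: "A x \<in> fmeasurable M" "?U \<in> fmeasurable M"
    using insert by (auto simp: fmeasurable_eq_sets)
  have "prob (A x \<inter> ?U) = prob (\<Union>i\<in>F. A x \<inter> A i)" by (simp only: Int_UN_distrib)
  also have "\<dots> \<le> (\<Sum>i\<in>F. prob (A x \<inter> A i))"
    using insert by (intro finite_measure_subadditive_finite) auto
  also have "\<dots> \<le> (\<Sum>i\<in>F. c)" using insert by (intro sum_mono) auto
  finally have int: "prob (A x \<inter> ?U) \<le> real (card F) * c" by simp
  have "(\<Sum>i\<in>insert x F. prob (A i)) - (real (card (insert x F)))\<^sup>2 * c
      = prob (A x) + ((\<Sum>i\<in>F. prob (A i)) - (real (card F))\<^sup>2 * c) - (2 * real (card F) + 1) * c"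
    using insert by (simp add: algebra_simps power2_eq_square)
  also have "\<dots> \<le> prob (A x) + prob ?U - real (card F) * c"
  proof -
    have "real (card F) * c \<le> (2 * real (card F) + 1) * c" using c(2) by (intro mult_right_mono) auto
    then show ?thesis using insert.IH insert.prems by simp
  qed
  also have "\<dots> \<le> prob (A x) + prob ?U - prob (A x \<inter> ?U)" using int by simp
  also have "\<dots> = prob (A x \<union> ?U)" by (rule measure_Un3[OF meas, symmetric])
  finally show ?case by simp
qed simp

section \<open>Words, edges and reachability in the tree\<close>

lemma vertices_iff: "w \<in> vertices d \<longleftrightarrow> set w \<subseteq> {..<d}"
  by (auto simp: vertices_def lists_eq_set)

lemma vertices_append [simp]: "v @ w \<in> vertices d \<longleftrightarrow> v \<in> vertices d \<and> w \<in> vertices d"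
  by (auto simp: vertices_iff)

lemma Nil_vertices [simp]: "[] \<in> vertices d"
  by (simp add: vertices_iff)

text \<open>An edge is determined by its length and its lower endpoint, since the upper endpoint is
  a prefix of that word.\<close>

lemma edges_of_length_iff:
  "(v, w) \<in> edges_of_length d n \<longleftrightarrow> w \<in> vertices d \<and> n \<le> length w \<and> v = take (length w - n) w"
proof
  assume "w \<in> vertices d \<and> n \<le> length w \<and> v = take (length w - n) w"
  then have v: "v @ drop (length w - n) w \<in> vertices d"
    and n: "length (drop (length w - n) w) = n" and w: "w = v @ drop (length w - n) w" by auto
  show "(v, w) \<in> edges_of_length d n"
    using v n by (subst w) (auto simp: edges_of_length_def simp del: length_drop)
qed (auto simp: edges_of_length_def)

lemma edges_of_length_append:
  "u \<in> vertices d \<Longrightarrow> (u @ v, u @ w) \<in> edges_of_length d n \<longleftrightarrow> (v, w) \<in> edges_of_length d n"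
  by (auto simp: edges_of_length_def)

lemma card_words:
  "finite {w \<in> vertices d. length w = n}" "card {w \<in> vertices d. length w = n} = d ^ n"
  using finite_lists_length_eq[of "{..<d}" n] card_lists_length_eq[of "{..<d}" n]
  by (simp_all add: vertices_iff)

locale tree_percolation = jump_lengths +
  fixes d :: nat
  assumes l_neq_k: "l \<noteq> k"
begin

abbreviation reach :: "(edge \<Rightarrow> bool) \<Rightarrow> vertex \<Rightarrow> bool" where
  "reach \<omega> w \<equiv> w \<in> root_cluster d l k \<omega>"

lemma edges_iff:
  "(v, w) \<in> edges d l k \<longleftrightarrow> w \<in> vertices d \<and>
    (l \<le> length w \<and> v = take (length w - l) w \<or> k \<le> length w \<and> v = take (length w - k) w)"
  by (auto simp: edges_def edges_of_length_iff)

lemma edges_append: "u \<in> vertices d \<Longrightarrow> (u @ v, u @ w) \<in> edges d l k \<longleftrightarrow> (v, w) \<in> edges d l k"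
  by (simp add: edges_def edges_of_length_append)

lemma edges_length_less: "(v, w) \<in> edges d l k \<Longrightarrow> length v < length w"
  using l_pos k_pos by (auto simp: edges_iff)

lemma reach_Nil [simp]: "reach \<omega> []"
  by (simp add: root_cluster_def)

lemma reach_iff:
  "reach \<omega> w \<longleftrightarrow> w = [] \<or> (\<exists>v. reach \<omega> v \<and> (v, w) \<in> edges d l k \<and> \<omega> (v, w))"
  (is "?l \<longleftrightarrow> ?r")
proof
  assume ?l
  then have "([], w) \<in> (open_edges d l k \<omega>)\<^sup>*" by (simp add: root_cluster_def)
  then show ?r by cases (auto simp: root_cluster_def open_edges_def)
next
  assume ?r
  then show ?l by (auto simp: root_cluster_def open_edges_def intro: rtrancl_into_rtrancl)
qed

lemma reach_vertices: "reach \<omega> w \<Longrightarrow> w \<in> vertices d"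
  by (subst (asm) reach_iff) (auto simp: edges_iff)

text \<open>Edges lead downwards, so a path to \<open>w\<close> uses no edge ending deeper than
  \<open>w\<close>. This locality is the source of independence from the edges further down.\<close>

lemma reach_cong:
  assumes "\<And>e. e \<in> edges d l k \<Longrightarrow> length (snd e) \<le> length w \<Longrightarrow> \<omega> e = \<omega>' e"
  shows "reach \<omega> w = reach \<omega>' w"
  using assms
proof (induction w rule: length_induct)
  case (1 w)
  have "(reach \<omega> v \<and> (v, w) \<in> edges d l k \<and> \<omega> (v, w)) = (reach \<omega>' v \<and> (v, w) \<in> edges d l k \<and> \<omega>' (v, w))" for v
  proof (cases "(v, w) \<in> edges d l k")
    case True
    then have "length v < length w" by (rule edges_length_less)
    then have "reach \<omega> v = reach \<omega>' v" using 1 by auto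
    then show ?thesis using 1(2)[OF True] by simp
  qed simp
  then show ?case by (subst (1 2) reach_iff) simp
qed

text \<open>Generations are finite, so an infinite cluster has unbounded depth. The right-hand side
  is a countable combination of events.\<close>

lemma infinite_root_cluster_iff:
  "infinite (root_cluster d l k \<omega>) \<longleftrightarrow> (\<forall>N. \<exists>w\<in>vertices d. N \<le> length w \<and> reach \<omega> w)"
proof
  assume inf: "infinite (root_cluster d l k \<omega>)"
  show "\<forall>N. \<exists>w\<in>vertices d. N \<le> length w \<and> reach \<omega> w"
  proof (rule ccontr)
    assume "\<not> ?thesis"
    then obtain N where "\<forall>w\<in>vertices d. reach \<omega> w \<longrightarrow> length w < N" by (auto simp: not_le)
    then have "root_cluster d l k \<omega> \<subseteq> (\<Union>n<N. {w \<in> vertices d. length w = n})"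
      using reach_vertices by blast
    then show False using inf finite_subset card_words(1) by blast
  qed
next
  assume R: "\<forall>N. \<exists>w\<in>vertices d. N \<le> length w \<and> reach \<omega> w"
  show "infinite (root_cluster d l k \<omega>)"
  proof
    assume "finite (root_cluster d l k \<omega>)"
    then have "finite (length ` root_cluster d l k \<omega>)" by simp
    then obtain N where "\<forall>n\<in>length ` root_cluster d l k \<omega>. n < N"
      using finite_nat_set_iff_bounded by blast
    then show False using R by (metis imageI not_le)
  qed
qed

text \<open>Follow an open path back from \<open>w\<close>: an edge spans at most
  \<open>max l k\<close> generations, so the path cannot skip the window.\<close>

lemma reach_window:
  assumes "reach \<omega> w" "N \<le> length w"
  shows "\<exists>a<max l k. \<exists>v\<in>vertices d. length v = N + a \<and> reach \<omega> v"
  using assms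
proof (induction w rule: length_induct)
  case (1 w)
  show ?case
  proof (cases "length w < N + max l k")
    case True
    then show ?thesis using 1(2,3) reach_vertices by (intro exI[of _ "length w - N"]) auto
  next
    case False
    then have "w \<noteq> []" using l_pos by auto
    then obtain v where v: "reach \<omega> v" "(v, w) \<in> edges d l k" using 1(2) by (subst (asm) reach_iff) auto
    then have "N \<le> length v" using False by (auto simp: edges_iff)
    then show ?thesis using 1(1) v edges_length_less by blast
  qed
qed

text \<open>Along the way from the root to \<open>w\<close> the reached vertices perform the chain above.\<close>

definition ages :: "(edge \<Rightarrow> bool) \<Rightarrow> vertex \<Rightarrow> nat set" where
  "ages \<omega> w = {a. a \<le> length w \<and> reach \<omega> (take (length w - a) w)}"

text \<open>\<open>A\<close> stands for the ages at the parent of \<open>w\<close>. As it is a fixed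
  argument, the event depends on \<open>\<omega>\<close> only through at most two edges into
  \<open>w\<close>.\<close>

definition arrives :: "(edge \<Rightarrow> bool) \<Rightarrow> nat set \<Rightarrow> vertex \<Rightarrow> bool" where
  "arrives \<omega> A w \<longleftrightarrow> l \<in> Suc ` A \<and> \<omega> (take (length w - l) w, w) \<or> k \<in> Suc ` A \<and> \<omega> (take (length w - k) w, w)"

lemma ages_Nil: "ages \<omega> [] = {0}"
  by (auto simp: ages_def)

lemma ages_subset: "ages \<omega> w \<subseteq> {..length w}"
  by (auto simp: ages_def)

lemma ages_snoc:
  assumes "w @ [i] \<in> vertices d"
  shows "ages \<omega> (w @ [i]) =
    (if arrives \<omega> (ages \<omega> w) (w @ [i]) then insert 0 (Suc ` ages \<omega> w) else Suc ` ages \<omega> w)"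
proof -
  have 1: "x \<in> Suc ` ages \<omega> w \<longleftrightarrow> x \<ge> 1 \<and> x \<le> length (w @ [i]) \<and> reach \<omega> (take (length (w @ [i]) - x) (w @ [i]))" for x
    by (cases x) (auto simp: ages_def)
  have 2: "x \<in> ages \<omega> (w @ [i]) \<longleftrightarrow> x = 0 \<and> reach \<omega> (w @ [i]) \<or> x \<in> Suc ` ages \<omega> w" for x
    unfolding 1 by (cases x) (simp_all add: ages_def)
  have "reach \<omega> (w @ [i]) \<longleftrightarrow>
      (\<exists>v. reach \<omega> v \<and> (v, w @ [i]) \<in> edges d l k \<and> \<omega> (v, w @ [i]))"
    by (subst reach_iff) simp
  also have "\<dots> \<longleftrightarrow> arrives \<omega> (ages \<omega> w) (w @ [i])"
    unfolding arrives_def 1 edges_iff using assms l_pos k_pos by blast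
  finally show ?thesis using 2 by auto
qed

end

section \<open>The percolation measure and the law of the ages along a branch\<close>

locale bernoulli_percolation = tree_percolation +
  fixes p q :: real
  assumes p: "p \<in> {0..1}" and q: "q \<in> {0..1}"
begin

definition coin :: "edge \<Rightarrow> bool measure" where
  "coin e = measure_pmf (bernoulli_pmf (if e \<in> edges_of_length d l then p else q))"

abbreviation M :: "(edge \<Rightarrow> bool) measure" where
  "M \<equiv> perc_measure d l k p q"

lemma M_eq: "M = PiM (edges d l k) coin"
  by (simp add: perc_measure_def coin_def[abs_def])

lemma prob_space_coin: "prob_space (coin e)"
  by (simp add: coin_def prob_space_measure_pmf)

lemma sets_coin [simp]: "sets (coin e) = UNIV" and space_coin [simp]: "space (coin e) = UNIV"
  by (simp_all add: coin_def)

sublocale prob_space M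
  unfolding M_eq by (intro prob_space_PiM prob_space_coin)

lemma space_M: "space M = (\<Pi>\<^sub>E e\<in>edges d l k. UNIV)"
  by (simp add: M_eq space_PiM)

lemma prob_conj_disjoint_edges:
  assumes "J \<subseteq> edges d l k" "L \<subseteq> edges d l k" "J \<inter> L = {}"
    and "Measurable.pred M P" "Measurable.pred M Q"
    and "\<And>\<omega> \<omega>'. (\<And>e. e \<in> J \<Longrightarrow> \<omega> e = \<omega>' e) \<Longrightarrow> P \<omega> = P \<omega>'"
    and "\<And>\<omega> \<omega>'. (\<And>e. e \<in> L \<Longrightarrow> \<omega> e = \<omega>' e) \<Longrightarrow> Q \<omega> = Q \<omega>'"
  shows "\<P>(\<omega> in M. P \<omega> \<and> Q \<omega>) = \<P>(\<omega> in M. P \<omega>) * \<P>(\<omega> in M. Q \<omega>)"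
proof (rule prob_conj_disjoint_coordinates[of "edges d l k" coin, folded M_eq])
  show "P \<omega> = P \<omega>'" if "\<And>e. e \<in> J \<Longrightarrow> \<omega> e = \<omega>' e" for \<omega> \<omega>' using that by (rule assms(6))
  show "Q \<omega> = Q \<omega>'" if "\<And>e. e \<in> L \<Longrightarrow> \<omega> e = \<omega>' e" for \<omega> \<omega>' using that by (rule assms(7))
qed (rule prob_space_coin assms)+

lemma pred_coord: "e \<in> edges d l k \<Longrightarrow> Measurable.pred M (\<lambda>\<omega>. \<omega> e)"
  unfolding M_eq by (rule measurable_PiM_component_rev) (auto simp: measurable_def)

lemma pred_reach [measurable]: "Measurable.pred M (\<lambda>\<omega>. reach \<omega> w)"
proof (induction w rule: length_induct)
  case (1 w)
  have "Measurable.pred M (\<lambda>\<omega>. reach \<omega> v \<and> (v, w) \<in> edges d l k \<and> \<omega> (v, w))" for v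
  proof (cases "(v, w) \<in> edges d l k")
    case True
    have [measurable]: "Measurable.pred M (\<lambda>\<omega>. reach \<omega> v)"
      using 1 edges_length_less[OF True] by blast
    note pred_coord[OF True, measurable]
    show ?thesis by measurable
  qed simp
  then have "Measurable.pred M (\<lambda>\<omega>. \<exists>v. reach \<omega> v \<and> (v, w) \<in> edges d l k \<and> \<omega> (v, w))"
    by (rule pred_intros_countable)
  then show ?case by (subst reach_iff, cases "w = []") simp_all
qed

lemma prob_coord:
  assumes "e \<in> edges d l k"
  shows "\<P>(\<omega> in M. \<omega> e) = (if e \<in> edges_of_length d l then p else q)"
proof -
  have "\<P>(\<omega> in M. \<omega> e) = measure (distr M (coin e) (\<lambda>\<omega>. \<omega> e)) {True}"
    using assms unfolding M_eq
    by (subst measure_distr) (auto intro!: arg_cong[where f = "measure _"])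
  also have "\<dots> = measure (coin e) {True}"
    unfolding M_eq by (subst distr_PiM_component) (use assms prob_space_coin in auto)
  finally show ?thesis using p q by (simp add: coin_def measure_pmf_single)
qed

lemma pred_ages [measurable]: "Measurable.pred M (\<lambda>\<omega>. ages \<omega> w = A)"
proof -
  have "(\<lambda>\<omega>. ages \<omega> w = A) =
      (\<lambda>\<omega>. \<forall>a. a \<in> A \<longleftrightarrow> a \<le> length w \<and> reach \<omega> (take (length w - a) w))"
    by (auto simp: ages_def fun_eq_iff)
  then show ?thesis by simp
qed

lemma arrives_edges:
  assumes w: "w \<in> vertices d" and A: "A \<subseteq> {..<length w}"
  shows "l \<in> Suc ` A \<Longrightarrow> (take (length w - l) w, w) \<in> edges d l k"
    and "k \<in> Suc ` A \<Longrightarrow> (take (length w - k) w, w) \<in> edges d l k"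
  using assms by (auto simp: edges_iff)

lemma pred_arrives:
  assumes w: "w \<in> vertices d" and A: "A \<subseteq> {..<length w}"
  shows "Measurable.pred M (\<lambda>\<omega>. arrives \<omega> A w)"
proof -
  have "Measurable.pred M (\<lambda>\<omega>. l \<in> Suc ` A \<and> \<omega> (take (length w - l) w, w))"
    using pred_coord[OF arrives_edges(1)[OF assms]] by (cases "l \<in> Suc ` A") auto
  moreover have "Measurable.pred M (\<lambda>\<omega>. k \<in> Suc ` A \<and> \<omega> (take (length w - k) w, w))"
    using pred_coord[OF arrives_edges(2)[OF assms]] by (cases "k \<in> Suc ` A") auto
  ultimately show ?thesis unfolding arrives_def by (rule pred_intros_logic)
qed

text \<open>The two edges into \<open>w\<close> differ because \<open>l \<noteq> k\<close>, so they
  are independent, and inclusion-exclusion gives \<open>p + q - p * q\<close> if both count.\<close>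

lemma prob_arrives:
  assumes w: "w \<in> vertices d" and A: "A \<subseteq> {..<length w}"
  shows "\<P>(\<omega> in M. arrives \<omega> A w) = arrival p q A"
proof -
  let ?e = "(take (length w - l) w, w)" and ?f = "(take (length w - k) w, w)"
  have e: "\<P>(\<omega> in M. \<omega> ?e) = p" if "l \<in> Suc ` A"
    using prob_coord[OF arrives_edges(1)[OF assms that]] that w A by (auto simp: edges_of_length_iff)
  have f: "\<P>(\<omega> in M. \<omega> ?f) = q" if "k \<in> Suc ` A"
  proof -
    have "k \<le> length w" using that A by auto
    then have "?f \<notin> edges_of_length d l" using l_neq_k
      by (auto simp: edges_of_length_iff dest!: arg_cong[where f = length])
    then show ?thesis using prob_coord[OF arrives_edges(2)[OF assms that]] by simp
  qed
  show ?thesis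
  proof (cases "l \<in> Suc ` A \<and> k \<in> Suc ` A")
    case True
    have le: "l \<le> length w" "k \<le> length w" using True A by auto
    note ef = arrives_edges(1)[OF assms conjunct1[OF True]] arrives_edges(2)[OF assms conjunct2[OF True]]
    note ef' = ef[THEN pred_coord]
    note ef'[measurable]
    have "?e \<noteq> ?f" using le l_neq_k by (auto dest!: arg_cong[where f = length])
    then have "\<P>(\<omega> in M. \<omega> ?e \<and> \<omega> ?f) = \<P>(\<omega> in M. \<omega> ?e) * \<P>(\<omega> in M. \<omega> ?f)"
      using ef ef' by (intro prob_conj_disjoint_edges[where J = "{?e}" and L = "{?f}"]) auto
    then have both: "\<P>(\<omega> in M. \<omega> ?e \<and> \<omega> ?f) = p * q" using e f True by simp
    have "\<P>(\<omega> in M. arrives \<omega> A w) = prob ({\<omega> \<in> space M. \<omega> ?e} \<union> {\<omega> \<in> space M. \<omega> ?f})"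
      using True by (intro arg_cong[where f = prob]) (auto simp: arrives_def)
    also have "\<dots> = p + q - p * q"
    proof -
      have "{\<omega> \<in> space M. \<omega> ?e} \<inter> {\<omega> \<in> space M. \<omega> ?f} = {\<omega> \<in> space M. \<omega> ?e \<and> \<omega> ?f}"
        by blast
      then show ?thesis
        using measure_Un3[OF predE[OF ef'(1), folded fmeasurable_eq_sets]
            predE[OF ef'(2), folded fmeasurable_eq_sets]]
          e f True both by simp
    qed
    finally show ?thesis using True by (simp add: arrival_def algebra_simps)
  next
    case False
    then consider "l \<in> Suc ` A" "k \<notin> Suc ` A" | "l \<notin> Suc ` A" "k \<in> Suc ` A" | "l \<notin> Suc ` A" "k \<notin> Suc ` A"
      by blast
    then show ?thesis by cases (simp_all add: arrives_def arrival_def e f)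
  qed
qed

lemma expectation_sum_of_bool:
  assumes "finite F" "\<And>i. i \<in> F \<Longrightarrow> Measurable.pred M (P i)"
  shows "expectation (\<lambda>\<omega>. \<Sum>i\<in>F. c i * of_bool (P i \<omega>)) = (\<Sum>i\<in>F. c i * \<P>(\<omega> in M. P i \<omega>))"
proof -
  have ind: "of_bool (P i \<omega>) = (indicator {\<omega> \<in> space M. P i \<omega>} \<omega> :: real)" if "\<omega> \<in> space M" for i \<omega>
    using that by (simp add: indicator_def of_bool_def)
  have "expectation (\<lambda>\<omega>. \<Sum>i\<in>F. c i * of_bool (P i \<omega>))
      = expectation (\<lambda>\<omega>. \<Sum>i\<in>F. c i * indicator {\<omega> \<in> space M. P i \<omega>} \<omega>)"
    by (intro Bochner_Integration.integral_cong sum.cong refl) (simp add: ind)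
  also have "\<dots> = (\<Sum>i\<in>F. c i * \<P>(\<omega> in M. P i \<omega>))"
    using assms by (subst Bochner_Integration.integral_sum) (auto simp: pred_def emeasure_eq_measure)
  finally show ?thesis .
qed

text \<open>This is the Markov property: the state at \<open>w\<close> depends on edges ending no
  deeper than \<open>w\<close>, the arrival at a child on edges ending there. The induction is for
  all \<open>f\<close>, since the last step along the branch acts on \<open>f\<close> first.\<close>

lemma expectation_ages:
  assumes "w \<in> vertices d"
  shows "expectation (\<lambda>\<omega>. f (ages \<omega> w)) = (step p q ^^ length w) f {0}"
  using assms
proof (induction w arbitrary: f rule: rev_induct)
  case Nil
  then show ?case by (simp add: ages_Nil prob_space)
next
  case (snoc i w)
  let ?w = "w @ [i]"
  let ?F = "Pow {..length w}"
  have w: "w \<in> vertices d" using snoc.prems by simp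
  have arr: "Measurable.pred M (\<lambda>\<omega>. arrives \<omega> A ?w)" "\<P>(\<omega> in M. arrives \<omega> A ?w) = arrival p q A"
    if "A \<in> ?F" for A
    using that pred_arrives[OF snoc.prems, of A] prob_arrives[OF snoc.prems, of A]
    by (auto simp: lessThan_Suc_atMost)
  have indep: "\<P>(\<omega> in M. ages \<omega> w = A \<and> arrives \<omega> A ?w = b)
      = \<P>(\<omega> in M. ages \<omega> w = A) * \<P>(\<omega> in M. arrives \<omega> A ?w = b)" if "A \<in> ?F" for A b
  proof (rule prob_conj_disjoint_edges[where
        J = "{e \<in> edges d l k. length (snd e) \<le> length w}" and L = "{e \<in> edges d l k. snd e = ?w}"])
    note arr(1)[OF that, measurable]
    show "Measurable.pred M (\<lambda>\<omega>. ages \<omega> w = A)" "Measurable.pred M (\<lambda>\<omega>. arrives \<omega> A ?w = b)"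
      by measurable
    fix \<omega> \<omega>' :: "edge \<Rightarrow> bool"
    {
      assume eq: "\<And>e. e \<in> {e \<in> edges d l k. length (snd e) \<le> length w} \<Longrightarrow> \<omega> e = \<omega>' e"
      have "reach \<omega> (take n w) = reach \<omega>' (take n w)" for n
        by (intro reach_cong eq) auto
      then show "(ages \<omega> w = A) = (ages \<omega>' w = A)" by (simp add: ages_def)
    next
      assume "\<And>e. e \<in> {e \<in> edges d l k. snd e = ?w} \<Longrightarrow> \<omega> e = \<omega>' e"
      then show "(arrives \<omega> A ?w = b) = (arrives \<omega>' A ?w = b)"
        using arrives_edges[OF snoc.prems, of A] that by (auto simp: arrives_def lessThan_Suc_atMost)
    }
  qed auto
  have pair: "\<P>(\<omega> in M. ages \<omega> w = A \<and> arrives \<omega> A ?w) = \<P>(\<omega> in M. ages \<omega> w = A) * arrival p q A"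
    "\<P>(\<omega> in M. ages \<omega> w = A \<and> \<not> arrives \<omega> A ?w) = \<P>(\<omega> in M. ages \<omega> w = A) * (1 - arrival p q A)"
    if "A \<in> ?F" for A
    using indep[OF that, of True] indep[OF that, of False] arr[OF that] prob_neg[of "\<lambda>\<omega>. arrives \<omega> A ?w"]
    by (simp_all add: pred_def)
  \<comment> \<open>The state takes finitely many values, so expectations of its functions become
    finite sums over \<open>A\<close>.\<close>
  have split: "f' (ages \<omega> w) = (\<Sum>A\<in>?F. f' A * of_bool (ages \<omega> w = A))" for f' :: "nat set \<Rightarrow> real" and \<omega>
    using ages_subset[of \<omega> w] by (subst sum.remove[of _ "ages \<omega> w"]) (auto intro!: sum.neutral)
  have "expectation (\<lambda>\<omega>. f (ages \<omega> ?w)) = expectation (\<lambda>\<omega>. \<Sum>(A, b)\<in>?F \<times> UNIV.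
      f (if b then insert 0 (Suc ` A) else Suc ` A) * of_bool (ages \<omega> w = A \<and> arrives \<omega> A ?w = b))"
  proof (intro Bochner_Integration.integral_cong refl)
    fix \<omega>
    have "f (ages \<omega> ?w) = (\<Sum>A\<in>?F. f (if arrives \<omega> A ?w then insert 0 (Suc ` A) else Suc ` A) * of_bool (ages \<omega> w = A))"
      unfolding ages_snoc[OF snoc.prems]
      using split[of "\<lambda>A. f (if arrives \<omega> A ?w then insert 0 (Suc ` A) else Suc ` A)" \<omega>] by simp
    then show "f (ages \<omega> ?w) = (\<Sum>(A, b)\<in>?F \<times> UNIV.
      f (if b then insert 0 (Suc ` A) else Suc ` A) * of_bool (ages \<omega> w = A \<and> arrives \<omega> A ?w = b))"
    proof (subst sum.cartesian_product[symmetric], elim trans, intro sum.cong refl)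
      fix A
      show "f (if arrives \<omega> A ?w then insert 0 (Suc ` A) else Suc ` A) * of_bool (ages \<omega> w = A)
          = (\<Sum>b\<in>UNIV. f (if b then insert 0 (Suc ` A) else Suc ` A)
              * of_bool (ages \<omega> w = A \<and> arrives \<omega> A ?w = b))"
        by (cases "arrives \<omega> A ?w"; cases "ages \<omega> w = A") (simp_all add: UNIV_bool)
    qed
  qed
  also have "\<dots> = (\<Sum>(A, b)\<in>?F \<times> UNIV. f (if b then insert 0 (Suc ` A) else Suc ` A)
      * \<P>(\<omega> in M. ages \<omega> w = A \<and> arrives \<omega> A ?w = b))"
    unfolding case_prod_beta using arr(1) by (intro expectation_sum_of_bool) auto
  also have "\<dots> = (\<Sum>A\<in>?F. step p q f A * \<P>(\<omega> in M. ages \<omega> w = A))"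
    by (subst sum.cartesian_product[symmetric])
      (auto simp: UNIV_bool pair step_def algebra_simps intro!: sum.cong)
  also have "\<dots> = expectation (\<lambda>\<omega>. \<Sum>A\<in>?F. step p q f A * of_bool (ages \<omega> w = A))"
    by (intro expectation_sum_of_bool[symmetric]) auto
  also have "\<dots> = expectation (\<lambda>\<omega>. step p q f (ages \<omega> w))"
    by (simp only: split[symmetric])
  also have "\<dots> = (step p q ^^ length ?w) f {0}"
    using snoc.IH[OF w] by (simp add: funpow_swap1)
  finally show ?case .
qed

lemma prob_reach:
  assumes "w \<in> vertices d"
  shows "\<P>(\<omega> in M. reach \<omega> w) = hit p q (length w) {0}"
proof -
  have "hit p q (length w) {0} = expectation (\<lambda>\<omega>. \<Sum>i\<in>{()}. 1 * of_bool (reach \<omega> w))"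
    unfolding hit_def expectation_ages[OF assms, symmetric] by (simp add: ages_def)
  also have "\<dots> = \<P>(\<omega> in M. reach \<omega> w)" by (subst expectation_sum_of_bool) auto
  finally show ?thesis by simp
qed

text \<open>An infinite cluster meets every window of generations; the rest is a union bound over
  the vertices in the window.\<close>

lemma theta_le_window:
  "theta d l k p q \<le> (\<Sum>a<max l k. d ^ (N + a) * hit p q (N + a) {0})"
proof -
  let ?V = "\<lambda>a. {w \<in> vertices d. length w = N + a}"
  have V: "\<P>(\<omega> in M. \<exists>w\<in>?V a. reach \<omega> w) \<le> d ^ (N + a) * hit p q (N + a) {0}" for a
  proof -
    have "{\<omega> \<in> space M. \<exists>w\<in>?V a. reach \<omega> w} = (\<Union>w\<in>?V a. {\<omega> \<in> space M. reach \<omega> w})" by auto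
    then have "\<P>(\<omega> in M. \<exists>w\<in>?V a. reach \<omega> w) \<le> (\<Sum>w\<in>?V a. \<P>(\<omega> in M. reach \<omega> w))"
      by (simp only:) (intro finite_measure_subadditive_finite card_words(1) image_subsetI predE pred_reach)
    also have "\<dots> = (\<Sum>w\<in>?V a. hit p q (N + a) {0})" by (intro sum.cong) (auto simp: prob_reach)
    finally show ?thesis by (simp add: card_words)
  qed
  have "theta d l k p q \<le> prob (\<Union>a<max l k. {\<omega> \<in> space M. \<exists>w\<in>?V a. reach \<omega> w})"
    unfolding theta_def
  proof (intro finite_measure_mono subsetI)
    fix \<omega> assume "\<omega> \<in> {\<omega> \<in> space M. infinite (root_cluster d l k \<omega>)}"
    then have "\<omega> \<in> space M" "\<exists>w. reach \<omega> w \<and> N \<le> length w" by (auto simp: infinite_root_cluster_iff)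
    then show "\<omega> \<in> (\<Union>a<max l k. {\<omega> \<in> space M. \<exists>w\<in>?V a. reach \<omega> w})"
      using reach_window by fastforce
  qed (auto intro!: sets.finite_UN predE pred_intros_finite card_words)
  also have "\<dots> \<le> (\<Sum>a<max l k. \<P>(\<omega> in M. \<exists>w\<in>?V a. reach \<omega> w))"
    by (intro finite_measure_subadditive_finite) (auto intro!: predE pred_intros_finite card_words)
  also have "\<dots> \<le> (\<Sum>a<max l k. d ^ (N + a) * hit p q (N + a) {0})" by (intro sum_mono V)
  finally show ?thesis .
qed

section \<open>Survival of an embedded branching process\<close>

text \<open>The configuration in the subtree at \<open>u\<close>, read as one on the whole tree. The
  restriction keeps it in the space of the product measure.\<close>

definition shift :: "vertex \<Rightarrow> (edge \<Rightarrow> bool) \<Rightarrow> edge \<Rightarrow> bool" where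
  "shift u \<omega> = (\<lambda>e\<in>edges d l k. \<omega> (u @ fst e, u @ snd e))"

lemma shift_space [simp]: "shift u \<omega> \<in> space M"
  by (simp add: shift_def space_M)

lemma coin_shift: "u \<in> vertices d \<Longrightarrow> coin (u @ fst e, u @ snd e) = coin e"
  by (cases e) (simp add: coin_def edges_of_length_append)

text \<open>Prefixing \<open>u\<close> is an injective map of edges that preserves lengths, hence
  also the laws of the coins.\<close>

lemma distr_shift:
  assumes "u \<in> vertices d"
  shows "distr M M (shift u) = M"
proof -
  let ?f = "\<lambda>e. (u @ fst e, u @ snd e)"
  have "inj_on ?f (edges d l k)" "?f \<in> edges d l k \<rightarrow> edges d l k"
    using assms by (auto intro!: inj_onI simp: edges_append)
  from distr_PiM_reindex[where M = coin, OF prob_space_coin this] show ?thesis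
    by (simp add: coin_shift assms M_eq shift_def[abs_def])
qed

lemma measurable_shift [measurable]:
  assumes "u \<in> vertices d"
  shows "shift u \<in> measurable M M"
  unfolding M_eq shift_def using assms
proof (intro measurable_restrict)
  fix e assume "e \<in> edges d l k"
  then have "(u @ fst e, u @ snd e) \<in> edges d l k" using assms by (simp add: edges_append)
  then show "(\<lambda>\<omega>. \<omega> (u @ fst e, u @ snd e)) \<in> measurable (PiM (edges d l k) coin) (coin e)"
    using measurable_component_singleton coin_shift[OF assms] by metis
qed

lemma reach_shift:
  assumes u: "reach \<omega> u"
  shows "reach (shift u \<omega>) w \<Longrightarrow> reach \<omega> (u @ w)"
proof (induction w rule: length_induct)
  case (1 w)
  show ?case
  proof (cases "w = []")
    case False
    then obtain v where v: "reach (shift u \<omega>) v" "(v, w) \<in> edges d l k" "shift u \<omega> (v, w)"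
      using 1(2) by (subst (asm) reach_iff) auto
    then have "reach \<omega> (u @ v)" using 1(1) edges_length_less by blast
    moreover have "(u @ v, u @ w) \<in> edges d l k" using v(2) reach_vertices[OF u] by (simp add: edges_append)
    ultimately show ?thesis using v by (subst reach_iff) (auto simp: shift_def)
  qed (use u in simp)
qed

text \<open>Survival up to generation \<open>m\<close> of a branching process whose individuals
  reproduce \<open>n\<close> tree generations at a time. Offspring of \<open>u\<close> are found
  with edges inside its own subtree only, which makes siblings independent.\<close>

primrec survives :: "nat \<Rightarrow> nat \<Rightarrow> (edge \<Rightarrow> bool) \<Rightarrow> bool" where
  "survives n 0 \<omega> \<longleftrightarrow> True"
| "survives n (Suc m) \<omega> \<longleftrightarrow> (\<exists>u\<in>{u \<in> vertices d. length u = n}. reach \<omega> u \<and> survives n m (shift u \<omega>))"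

lemma pred_survives [measurable]: "Measurable.pred M (survives n m)"
proof (induction m)
  case (Suc m)
  show ?case unfolding survives.simps
  proof (intro pred_intros_countable_bounded pred_intros_logic pred_reach)
    fix u assume "u \<in> {u \<in> vertices d. length u = n}"
    then show "Measurable.pred M (\<lambda>\<omega>. survives n m (shift u \<omega>))"
      using measurable_compose[OF measurable_shift Suc] by simp
  qed
qed simp

lemma survives_antimono: "survives n (Suc m) \<omega> \<Longrightarrow> survives n m \<omega>"
  by (induction m arbitrary: \<omega>) auto

lemma survives_reach: "survives n m \<omega> \<Longrightarrow> \<exists>w\<in>vertices d. length w = m * n \<and> reach \<omega> w"
proof (induction m arbitrary: \<omega>)
  case (Suc m)
  then obtain u where u: "u \<in> vertices d" "length u = n" "reach \<omega> u" "survives n m (shift u \<omega>)" by auto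
  then obtain w where "w \<in> vertices d" "length w = m * n" "reach (shift u \<omega>) w" using Suc.IH by blast
  then show ?case using u reach_shift by (intro bexI[of _ "u @ w"]) auto
qed (use Nil_vertices in force)

lemma prob_survives_shift:
  assumes "u \<in> vertices d"
  shows "\<P>(\<omega> in M. survives n m (shift u \<omega>)) = \<P>(\<omega> in M. survives n m \<omega>)"
proof -
  have "\<P>(\<omega> in M. survives n m \<omega>) = measure (distr M M (shift u)) {\<omega> \<in> space M. survives n m \<omega>}"
    by (simp add: distr_shift assms)
  also have "\<dots> = \<P>(\<omega> in M. survives n m (shift u \<omega>))"
    using assms by (subst measure_distr) (auto intro!: arg_cong[where f = prob])
  finally show ?thesis by simp
qed

abbreviation below :: "vertex \<Rightarrow> edge set" where
  "below u \<equiv> (\<lambda>e. (u @ fst e, u @ snd e)) ` edges d l k"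

lemma below_subset: "u \<in> vertices d \<Longrightarrow> below u \<subseteq> edges d l k"
  by (auto simp: edges_append)

lemma survives_shift_cong:
  assumes "\<And>e. e \<in> below u \<Longrightarrow> \<omega> e = \<omega>' e"
  shows "survives n m (shift u \<omega>) = survives n m (shift u \<omega>')"
proof -
  have "shift u \<omega> = shift u \<omega>'"
    unfolding shift_def by (intro restrict_ext assms imageI)
  then show ?thesis by simp
qed

lemma pred_survives_shift: "u \<in> vertices d \<Longrightarrow> Measurable.pred M (\<lambda>\<omega>. survives n m (shift u \<omega>))"
  using measurable_compose[OF measurable_shift pred_survives] by simp

text \<open>Reaching \<open>u\<close> uses edges ending no deeper than \<open>u\<close>, while
  survival from \<open>u\<close> uses edges within its subtree, all of which end deeper.\<close>

lemma prob_reach_survives: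
  assumes u: "u \<in> vertices d"
  shows "\<P>(\<omega> in M. reach \<omega> u \<and> survives n m (shift u \<omega>))
    = hit p q (length u) {0} * \<P>(\<omega> in M. survives n m \<omega>)"
proof -
  have "\<P>(\<omega> in M. reach \<omega> u \<and> survives n m (shift u \<omega>))
      = \<P>(\<omega> in M. reach \<omega> u) * \<P>(\<omega> in M. survives n m (shift u \<omega>))"
  proof (rule prob_conj_disjoint_edges[where
        J = "{e \<in> edges d l k. length (snd e) \<le> length u}" and L = "below u"])
    show "reach \<omega> u = reach \<omega>' u"
      if "\<And>e. e \<in> {e \<in> edges d l k. length (snd e) \<le> length u} \<Longrightarrow> \<omega> e = \<omega>' e" for \<omega> \<omega>'
      by (intro reach_cong that) auto
    show "{e \<in> edges d l k. length (snd e) \<le> length u} \<inter> below u = {}"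
      using edges_length_less by fastforce
  qed (intro below_subset[OF u] pred_reach pred_survives_shift[OF u] survives_shift_cong Collect_subset
      | assumption)+
  then show ?thesis by (simp add: prob_reach prob_survives_shift u)
qed

text \<open>Distinct vertices of the same generation have disjoint subtrees.\<close>

lemma prob_survives_survives:
  assumes u: "u \<in> vertices d" "v \<in> vertices d" "length u = length v" "u \<noteq> v"
  shows "\<P>(\<omega> in M. survives n m (shift u \<omega>) \<and> survives n m (shift v \<omega>))
    = (\<P>(\<omega> in M. survives n m \<omega>))\<^sup>2"
proof -
  have "\<P>(\<omega> in M. survives n m (shift u \<omega>) \<and> survives n m (shift v \<omega>))
      = \<P>(\<omega> in M. survives n m (shift u \<omega>)) * \<P>(\<omega> in M. survives n m (shift v \<omega>))"
  proof (rule prob_conj_disjoint_edges[where J = "below u" and L = "below v"])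
    show "below u \<inter> below v = {}" using u by auto
  qed (intro below_subset pred_survives_shift survives_shift_cong u | assumption)+
  then show ?thesis by (simp add: prob_survives_shift u power2_eq_square)
qed

text \<open>Bonferroni over the \<open>d ^ n\<close> possible children. For a pair, dropping the
  requirement that both be reached leaves two independent survivals.\<close>

lemma prob_survives_Suc_ge:
  "real d ^ n * hit p q n {0} * \<P>(\<omega> in M. survives n m \<omega>) - (real d ^ n)\<^sup>2 * (\<P>(\<omega> in M. survives n m \<omega>))\<^sup>2
    \<le> \<P>(\<omega> in M. survives n (Suc m) \<omega>)"
proof -
  let ?V = "{u \<in> vertices d. length u = n}"
  let ?A = "\<lambda>u. {\<omega> \<in> space M. reach \<omega> u \<and> survives n m (shift u \<omega>)}"
  have A: "?A u \<in> events" if "u \<in> ?V" for u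
    using that pred_survives_shift by (intro predE pred_intros_logic pred_reach) auto
  have "(\<Sum>u\<in>?V. prob (?A u)) - (real (card ?V))\<^sup>2 * (\<P>(\<omega> in M. survives n m \<omega>))\<^sup>2
      \<le> prob (\<Union>u\<in>?V. ?A u)"
  proof (intro prob_UN_ge A)
    fix u v assume uv: "u \<in> ?V" "v \<in> ?V" "u \<noteq> v"
    have "prob (?A u \<inter> ?A v) \<le> \<P>(\<omega> in M. survives n m (shift u \<omega>) \<and> survives n m (shift v \<omega>))"
      using uv pred_survives_shift by (intro finite_measure_mono predE pred_intros_logic) auto
    then show "prob (?A u \<inter> ?A v) \<le> (\<P>(\<omega> in M. survives n m \<omega>))\<^sup>2"
      using prob_survives_survives[of u v n m] uv by simp
  qed (auto simp: card_words)
  moreover have "(\<Union>u\<in>?V. ?A u) = {\<omega> \<in> space M. survives n (Suc m) \<omega>}" by auto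
  moreover have "(\<Sum>u\<in>?V. prob (?A u)) = (\<Sum>u\<in>?V. hit p q n {0} * \<P>(\<omega> in M. survives n m \<omega>))"
    by (intro sum.cong) (auto simp: prob_reach_survives)
  ultimately show ?thesis by (simp add: card_words mult.assoc)
qed

text \<open>A single line of descent through the word of \<open>n\<close> zeros suffices. Positivity
  permits the cancellation in the next lemma.\<close>

lemma prob_survives_pos:
  assumes d: "1 \<le> d" and n: "0 < hit p q n {0}"
  shows "0 < \<P>(\<omega> in M. survives n m \<omega>)"
proof (induction m)
  case (Suc m)
  define u :: vertex where "u = replicate n 0"
  have u: "u \<in> vertices d" "length u = n" using d by (auto simp: u_def vertices_iff)
  have "0 < \<P>(\<omega> in M. reach \<omega> u \<and> survives n m (shift u \<omega>))"
    using Suc n by (simp add: prob_reach_survives u)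
  also have "\<dots> \<le> \<P>(\<omega> in M. survives n (Suc m) \<omega>)"
    using u by (intro finite_measure_mono predE pred_survives) auto
  finally show ?case .
qed (simp add: prob_space)

text \<open>From \<open>\<mu> f - D f\<^sup>2 \<le> f\<close> and \<open>f > 0\<close> one may cancel \<open>f\<close>, which bounds the survival
  probabilities below uniformly in the number of steps.\<close>

lemma theta_pos:
  assumes d: "1 \<le> d" and n: "1 < real d ^ n * hit p q n {0}"
  shows "0 < theta d l k p q"
proof -
  define \<mu> where "\<mu> = real d ^ n * hit p q n {0}"
  define D where "D = (real d ^ n)\<^sup>2"
  define f where "f m = \<P>(\<omega> in M. survives n m \<omega>)" for m
  have D: "0 < D" using d by (simp add: D_def)
  have hit: "0 < hit p q n {0}"
    using n hit_nonneg[OF p q, of n "{0}"] by (cases "hit p q n {0} = 0") auto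
  have low: "(\<mu> - 1) / D \<le> f m" for m
  proof -
    have pos: "0 < f m" unfolding f_def using d hit by (rule prob_survives_pos)
    have "\<mu> * f m - D * (f m)\<^sup>2 \<le> f (Suc m)"
      using prob_survives_Suc_ge[of n m] by (simp add: f_def \<mu>_def D_def)
    also have "\<dots> \<le> f m" unfolding f_def
      using survives_antimono by (intro finite_measure_mono predE pred_survives) blast
    finally have "(\<mu> - D * f m) * f m \<le> 1 * f m" by (simp add: algebra_simps power2_eq_square)
    then have "\<mu> - D * f m \<le> 1" using pos by simp
    then show ?thesis using D by (simp add: pos_divide_le_eq algebra_simps)
  qed
  \<comment> \<open>Surviving every number of blocks is a decreasing intersection of events of
    probability at least \<open>(\<mu> - 1) / D\<close>.\<close>
  let ?S = "\<lambda>m. {\<omega> \<in> space M. survives n m \<omega>}"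
  have "(\<lambda>m. prob (?S m)) \<longlonglongrightarrow> prob (\<Inter>m. ?S m)"
    using survives_antimono by (intro finite_Lim_measure_decseq decseq_SucI) (auto intro: predE pred_survives)
  then have "(\<mu> - 1) / D \<le> prob (\<Inter>m. ?S m)"
    using low by (intro tendsto_lowerbound[OF _ _ sequentially_bot]) (auto simp: f_def)
  also have "\<dots> \<le> theta d l k p q" unfolding theta_def
  proof (intro finite_measure_mono subsetI)
    fix \<omega> assume \<omega>: "\<omega> \<in> (\<Inter>m. ?S m)"
    \<comment> \<open>Since \<open>n\<close> is positive, surviving \<open>N\<close> blocks reaches
      depth \<open>N * n\<close>, which is at least \<open>N\<close>.\<close>
    have "n \<noteq> 0" using n by (intro notI) simp
    have "\<exists>w\<in>vertices d. N \<le> length w \<and> reach \<omega> w" for N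
    proof -
      obtain w where "w \<in> vertices d" "length w = N * n" "reach \<omega> w"
        using survives_reach[of n N \<omega>] \<omega> by auto
      then show ?thesis using \<open>n \<noteq> 0\<close> by (intro bexI[of _ w]) auto
    qed
    then show "\<omega> \<in> {\<omega> \<in> space M. infinite (root_cluster d l k \<omega>)}"
      using \<omega> by (auto simp: infinite_root_cluster_iff)
  qed (unfold infinite_root_cluster_iff, measurable)
  finally have "(\<mu> - 1) / D \<le> theta d l k p q" .
  moreover have "0 < (\<mu> - 1) / D" using n D by (simp add: \<mu>_def)
  ultimately show ?thesis by linarith
qed

end

section \<open>Strict monotonicity of the critical parameters\<close>

text \<open>The definition of the measure tests for length \<open>l\<close> first; as the two
  classes of edges are disjoint, testing for \<open>k\<close> first gives the same coins.\<close>

lemma theta_commute: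
  assumes "l \<noteq> k" "p \<in> {0..1}"
  shows "theta d l k p q = theta d k l q p"
proof -
  have E: "edges d l k = edges d k l" by (auto simp: edges_def)
  have "e \<notin> edges_of_length d l \<or> e \<notin> edges_of_length d k" for e
    using \<open>l \<noteq> k\<close> by (auto simp: edges_of_length_def)
  then have "perc_measure d l k p q = perc_measure d k l q p"
    unfolding perc_measure_def E by (intro PiM_cong refl) (auto simp: edges_def)
  then show ?thesis
    by (simp add: theta_def root_cluster_def open_edges_def E)
qed

text \<open>The lengths are distinct but in either order, because the second claim of the theorem
  exchanges them.\<close>

lemma p_crit_strict:
  assumes d: "2 \<le> d" and lk: "1 \<le> l" "1 \<le> k" "l \<noteq> k"
    and q: "q \<in> {0..1}" "q' \<in> {0..1}" "q < q'" and pos: "0 < p_crit d l k q"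
  shows "p_crit d l k q' < p_crit d l k q"
proof -
  let ?p = "p_crit d l k q"
  let ?X = "\<lambda>q. {p \<in> {0<..<1}. theta d l k p q > 0}"
  interpret jump_lengths l k using lk by unfold_locales
  have perc: "bernoulli_percolation l k p q" if "p \<in> {0..1}" "q \<in> {0..1}" for p q
    using lk that by unfold_locales auto
  have bdd: "bdd_below (?X r)" for r by (auto intro!: bdd_belowI[of _ 0])
  \<comment> \<open>Any \<open>r\<close> strictly between \<open>1 / d ^ l\<close> and 1 works: the
    edges of length \<open>l\<close> alone give a mean above 1 in generation \<open>l\<close>. So
    the infimum is over a nonempty set and below 1.\<close>
  obtain r where r: "r \<in> ?X q"
  proof -
    have "1 < real d ^ l" using d lk by (simp add: one_less_power)
    then have "1 / real d ^ l < 1" using d by (subst divide_less_eq_1_pos) auto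
    then obtain r where r: "1 / real d ^ l < r" "r < 1" using dense by blast
    have r0: "0 < r" using r(1) by (rule le_less_trans[rotated]) simp
    have "1 < real d ^ l * r" using r d by (simp add: pos_divide_less_eq mult.commute)
    also have "\<dots> \<le> real d ^ l * hit r q l {0}"
      using r r0 q by (intro mult_left_mono hit_l_ge) auto
    finally have "0 < theta d l k r q"
      using r r0 q d by (intro bernoulli_percolation.theta_pos[OF perc]) auto
    then show ?thesis using r r0 that by simp
  qed
  have "?p \<le> r" unfolding p_crit_def by (intro cInf_lower r bdd)
  then have p1: "?p < 1" using r by simp
  have "\<exists>p\<in>?X q. p < ?p + 1 / real (Suc n)" for n
    using r bdd cInf_less_iff[of "?X q" "?p + 1 / real (Suc n)"] by (auto simp: p_crit_def)
  then obtain P where P: "\<And>n. P n \<in> ?X q" "\<And>n. P n < ?p + 1 / real (Suc n)" by metis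
  have lim: "P \<longlonglongrightarrow> ?p"
  proof (rule tendsto_sandwich[OF _ _ tendsto_const])
    show "\<forall>\<^sub>F n in sequentially. ?p \<le> P n"
      unfolding p_crit_def by (intro always_eventually allI cInf_lower P bdd)
    show "\<forall>\<^sub>F n in sequentially. P n \<le> ?p + 1 / real (Suc n)"
      using P(2) by (intro always_eventually allI less_imp_le)
    show "(\<lambda>n. ?p + 1 / real (Suc n)) \<longlonglongrightarrow> ?p"
      using tendsto_add[OF tendsto_const[of ?p] LIMSEQ_inverse_real_of_nat] by (simp add: inverse_eq_divide)
  qed
  have "\<exists>p\<in>{0<..<?p}. \<exists>n. 1 < real d ^ n * hit p q' n {0}"
  proof (rule mean_hits_gt_1_below[OF pos p1 q _ _ lim])
    fix n
    have Pn: "P n \<in> {0..1}" using P(1)[of n] by simp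
    then show "P n \<in> {0..1}" .
    show "\<exists>\<theta>>0. \<forall>N. \<theta> \<le> (\<Sum>a<max l k. real d ^ (N + a) * hit (P n) q (N + a) {0})"
      using bernoulli_percolation.theta_le_window[OF perc[OF Pn q(1)]] P(1)[of n]
      by (intro exI[of _ "theta d l k (P n) q"]) auto
  qed (use d in simp)
  then obtain p n where p: "0 < p" "p < ?p" and n: "1 < real d ^ n * hit p q' n {0}" by auto
  have "0 < theta d l k p q'"
    using p p1 q d n by (intro bernoulli_percolation.theta_pos[OF perc]) auto
  then have "p_crit d l k q' \<le> p"
    unfolding p_crit_def using p p1 by (intro cInf_lower bdd) auto
  then show ?thesis using p by simp
qed

theorem theorem3:
  fixes d l k :: nat
  assumes "d \<ge> 2" and "1 \<le> l" and "l < k"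
  shows "(\<forall>q' q'' :: real. q' \<in> {0..1} \<longrightarrow> q'' \<in> {0..1} \<longrightarrow> q' > q'' \<longrightarrow> q'' > 0 \<longrightarrow>
            p_crit d l k q'' > 0 \<longrightarrow> p_crit d l k q' < p_crit d l k q'') \<and>
         (\<forall>p' p'' :: real. p' \<in> {0..1} \<longrightarrow> p'' \<in> {0..1} \<longrightarrow> p' > p'' \<longrightarrow> p'' > 0 \<longrightarrow>
            q_crit d l k p'' > 0 \<longrightarrow> q_crit d l k p' < q_crit d l k p'')"
proof -
  \<comment> \<open>Exchanging the lengths turns \<open>q_crit\<close> into
    \<open>p_crit\<close>.\<close>
  have "q_crit d l k p = p_crit d k l p" if "p \<in> {0..1}" for p
    using assms that by (simp add: q_crit_def p_crit_def theta_commute)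
  then show ?thesis
    using assms p_crit_strict[of d l k] p_crit_strict[of d k l] by simp
qed

end
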